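(* Let $k\ge1$ and let $\Lambda$ be a source-free, row-finite nontrivial monoid $k$-graph, i.e. $|\Lambda^0|=1$ and $B_i\neq0$ for some $1\le i\le k$. Let $g:=\gcd(B_1,\dots,B_k)$. Then the $E^2$ page of the Kasparov--Schochet spectral sequence for $K_*(C^*(\Lambda))$ has the form $$E^2_{p,q}\cong\begin{cases}\mathbb{Z}_g^{\binom{k-1}{p}}, & q \text{ even},\\ 0,&\text{otherwise.}\end{cases}$$
   Context: $0\in\mathbb{N}$. A $k$-graph is a countable category $\Lambda$ with a functor $d:\Lambda\to\mathbb{N}^k$ such that whenever $d(\lambda)=m+n$ there are unique $\mu,\nu\in\Lambda$ with $d(\mu)=m$, $d(\nu)=n$ and $\lambda=\mu\nu$. $\Lambda^0$ is its object set, $r,s$ the range and source maps. $\Lambda$ is row-finite (resp. source-free) if $r^{-1}(v)\cap d^{-1}(n)$ is finite (resp. nonempty) for all $v\in\Lambda^0$, $n\in\mathbb{N}^k$. A monoid $k$-graph is a $k$-graph with exactly one vertex. Let $e_i$ be the $i$-th canonical generator of $\mathbb{N}^k$. For a monoid $k$-graph, the adjacency matrix of the $i$-th coordinate graph is the $1\times1$ matrix $M_i=|d^{-1}(e_i)|$, and the co-adjacency matrix is the integer $B_i:=1-M_i$. For $1\le p\le k$, $N_{p,k}$ is the set of tuples $a=(a_1,\dots,a_p)\in\{1,\dots,k\}^p$ with $a_1<\cdots<a_p$, and $N_{0,k}=\{*\}$; $a^i\in N_{p-1,k}$ is $a$ with its $i$-th coordinate removed ($a^1=*$ if $p=1$).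 The Evans chain complex $\mathcal{D}$ of a monoid $k$-graph has $\mathcal{D}_p=\bigoplus_{a\in N_{p,k}}\mathbb{Z}$ for $0\le p\le k$ and $\mathcal{D}_p=0$ otherwise, with differentials, for $1\le p\le k$, $$\partial_p\Big(\bigoplus_{a\in N_{p,k}}m_a\Big)=\bigoplus_{b\in N_{p-1,k}}\ \sum_{a\in N_{p,k}}\sum_{i=1}^p(-1)^{i+1}\delta_{b,a^i}B_{a_i}m_a.$$ The Kasparov--Schochet spectral sequence is the spectral sequence (Evans) converging to $K_*(C^*(\Lambda))$, where $C^*(\Lambda)$ is the higher-rank graph $C^*$-algebra of $\Lambda$. Its $E^2$ page is given by $E^2_{p,q}\cong H_p(\mathcal{D})$ if $0\le p\le k$ and $q$ is even, and $E^2_{p,q}=0$ otherwise. $\mathbb{Z}_g=\mathbb{Z}/g\mathbb{Z}$ (so $\mathbb{Z}_1=0$), the gcd is taken positive, and $\binom{k-1}{p}=0$ if $p<0$ or $p>k-1$. *)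

theory Defs
  imports "HOL-Algebra.Algebra" "HOL-Library.Countable_Set"
begin

section \<open>Higher-rank graphs\<close>

text \<open>The monoid \<open>\<nat>\<^sup>k\<close> is the set of functions \<open>nat \<Rightarrow> nat\<close> supported on the coordinates
  \<open>{1..k}\<close>, with pointwise addition.\<close>

definition Nat_pow :: "nat \<Rightarrow> (nat \<Rightarrow> nat) set" where
  "Nat_pow k = {n. \<forall>i. i \<notin> {1..k} \<longrightarrow> n i = 0}"

definition unit_deg :: "nat \<Rightarrow> (nat \<Rightarrow> nat)" where
  "unit_deg i = (\<lambda>j. if j = i then 1 else 0)"

record ('o, 'm) kgraph =
  Obj :: "'o set"
  Mor :: "'m set"
  rng :: "'m \<Rightarrow> 'o"
  src :: "'m \<Rightarrow> 'o"
  ident :: "'o \<Rightarrow> 'm"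
  comp :: "'m \<Rightarrow> 'm \<Rightarrow> 'm"
  dg :: "'m \<Rightarrow> nat \<Rightarrow> nat"

text \<open>The composite \<open>comp \<Lambda> \<mu> \<nu>\<close>, written \<open>\<mu>\<nu>\<close> on paper, is meaningful exactly when
  \<open>src \<Lambda> \<mu> = rng \<Lambda> \<nu>\<close>.\<close>

locale k_graph =
  fixes k :: nat and \<Lambda> :: "('o, 'm) kgraph"
  assumes countable_Obj: "countable (Obj \<Lambda>)"
    and countable_Mor: "countable (Mor \<Lambda>)"
    and rng_in: "\<mu> \<in> Mor \<Lambda> \<Longrightarrow> rng \<Lambda> \<mu> \<in> Obj \<Lambda>"
    and src_in: "\<mu> \<in> Mor \<Lambda> \<Longrightarrow> src \<Lambda> \<mu> \<in> Obj \<Lambda>"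
    and ident_in: "v \<in> Obj \<Lambda> \<Longrightarrow> ident \<Lambda> v \<in> Mor \<Lambda>"
    and rng_ident: "v \<in> Obj \<Lambda> \<Longrightarrow> rng \<Lambda> (ident \<Lambda> v) = v"
    and src_ident: "v \<in> Obj \<Lambda> \<Longrightarrow> src \<Lambda> (ident \<Lambda> v) = v"
    and comp_in: "\<lbrakk>\<mu> \<in> Mor \<Lambda>; \<nu> \<in> Mor \<Lambda>; src \<Lambda> \<mu> = rng \<Lambda> \<nu>\<rbrakk> \<Longrightarrow> comp \<Lambda> \<mu> \<nu> \<in> Mor \<Lambda>"
    and rng_comp: "\<lbrakk>\<mu> \<in> Mor \<Lambda>; \<nu> \<in> Mor \<Lambda>; src \<Lambda> \<mu> = rng \<Lambda> \<nu>\<rbrakk> \<Longrightarrow> rng \<Lambda> (comp \<Lambda> \<mu> \<nu>) = rng \<Lambda> \<mu>"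
    and src_comp: "\<lbrakk>\<mu> \<in> Mor \<Lambda>; \<nu> \<in> Mor \<Lambda>; src \<Lambda> \<mu> = rng \<Lambda> \<nu>\<rbrakk> \<Longrightarrow> src \<Lambda> (comp \<Lambda> \<mu> \<nu>) = src \<Lambda> \<nu>"
    and comp_assoc: "\<lbrakk>\<mu> \<in> Mor \<Lambda>; \<nu> \<in> Mor \<Lambda>; \<xi> \<in> Mor \<Lambda>; src \<Lambda> \<mu> = rng \<Lambda> \<nu>; src \<Lambda> \<nu> = rng \<Lambda> \<xi>\<rbrakk>
           \<Longrightarrow> comp \<Lambda> (comp \<Lambda> \<mu> \<nu>) \<xi> = comp \<Lambda> \<mu> (comp \<Lambda> \<nu> \<xi>)"
    and ident_left: "\<mu> \<in> Mor \<Lambda> \<Longrightarrow> comp \<Lambda> (ident \<Lambda> (rng \<Lambda> \<mu>)) \<mu> = \<mu>"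
    and ident_right: "\<mu> \<in> Mor \<Lambda> \<Longrightarrow> comp \<Lambda> \<mu> (ident \<Lambda> (src \<Lambda> \<mu>)) = \<mu>"
    and dg_in: "\<mu> \<in> Mor \<Lambda> \<Longrightarrow> dg \<Lambda> \<mu> \<in> Nat_pow k"
    and dg_ident: "v \<in> Obj \<Lambda> \<Longrightarrow> dg \<Lambda> (ident \<Lambda> v) = (\<lambda>i. 0)"
    and dg_comp: "\<lbrakk>\<mu> \<in> Mor \<Lambda>; \<nu> \<in> Mor \<Lambda>; src \<Lambda> \<mu> = rng \<Lambda> \<nu>\<rbrakk>
           \<Longrightarrow> dg \<Lambda> (comp \<Lambda> \<mu> \<nu>) = (\<lambda>i. dg \<Lambda> \<mu> i + dg \<Lambda> \<nu> i)"
    and unique_factorisation: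
      "\<lbrakk>\<xi> \<in> Mor \<Lambda>; m \<in> Nat_pow k; n \<in> Nat_pow k; dg \<Lambda> \<xi> = (\<lambda>i. m i + n i)\<rbrakk>
           \<Longrightarrow> \<exists>!(\<mu>, \<nu>). \<mu> \<in> Mor \<Lambda> \<and> \<nu> \<in> Mor \<Lambda> \<and> src \<Lambda> \<mu> = rng \<Lambda> \<nu> \<and>
                 dg \<Lambda> \<mu> = m \<and> dg \<Lambda> \<nu> = n \<and> \<xi> = comp \<Lambda> \<mu> \<nu>"

definition row_finite :: "nat \<Rightarrow> ('o, 'm) kgraph \<Rightarrow> bool" where
  "row_finite k \<Lambda> \<longleftrightarrow>
     (\<forall>v\<in>Obj \<Lambda>. \<forall>n\<in>Nat_pow k. finite {\<mu> \<in> Mor \<Lambda>. rng \<Lambda> \<mu> = v \<and> dg \<Lambda> \<mu> = n})"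

definition source_free :: "nat \<Rightarrow> ('o, 'm) kgraph \<Rightarrow> bool" where
  "source_free k \<Lambda> \<longleftrightarrow>
     (\<forall>v\<in>Obj \<Lambda>. \<forall>n\<in>Nat_pow k. {\<mu> \<in> Mor \<Lambda>. rng \<Lambda> \<mu> = v \<and> dg \<Lambda> \<mu> = n} \<noteq> {})"

locale monoid_k_graph = k_graph +
  assumes one_vertex: "card (Obj \<Lambda>) = 1"

text \<open>For a monoid \<open>k\<close>-graph the adjacency and co-adjacency matrices are \<open>1 \<times> 1\<close>; they are
  identified with their entries \<open>M\<^sub>i\<close> and \<open>B\<^sub>i\<close>.\<close>

definition adjacency :: "('o, 'm) kgraph \<Rightarrow> nat \<Rightarrow> nat" where
  "adjacency \<Lambda> i = card {\<mu> \<in> Mor \<Lambda>. dg \<Lambda> \<mu> = unit_deg i}"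

definition coadjacency :: "('o, 'm) kgraph \<Rightarrow> nat \<Rightarrow> int" where
  "coadjacency \<Lambda> i = 1 - int (adjacency \<Lambda> i)"


section \<open>The Evans chain complex\<close>

text \<open>Tuples are lists, so \<open>N\<^sub>0\<^sub>,\<^sub>k = {[]}\<close> and \<open>*\<close> is the empty list. List positions start
  at \<open>0\<close> whereas tuple coordinates start at \<open>1\<close>. The index set is made empty for \<open>p < 0\<close> and
  \<open>p > k\<close>, so that the direct sum over it is the trivial group there.\<close>

definition tuples :: "nat \<Rightarrow> int \<Rightarrow> nat list set" where
  "tuples k p = (if 0 \<le> p \<and> p \<le> int k
     then {a. length a = nat p \<and> set a \<subseteq> {1..k} \<and> sorted_wrt (<) a} else {})"

definition coord :: "nat list \<Rightarrow> nat \<Rightarrow> nat" where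
  "coord a i = a ! (i - 1)"

definition remove_coord :: "nat \<Rightarrow> nat list \<Rightarrow> nat list" where
  "remove_coord i a = take (i - 1) a @ drop i a"

definition evans_chain :: "nat \<Rightarrow> int \<Rightarrow> (nat list \<Rightarrow> int) monoid" where
  "evans_chain k p = sum_group (tuples k p) (\<lambda>_. integer_group)"

text \<open>Outside \<open>1 \<le> p \<le> k\<close> the formula below is automatically the zero map, since its source or
  target is trivial.\<close>

definition evans_diff ::
    "nat \<Rightarrow> ('o, 'm) kgraph \<Rightarrow> int \<Rightarrow> (nat list \<Rightarrow> int) \<Rightarrow> (nat list \<Rightarrow> int)" where
  "evans_diff k \<Lambda> p m = (\<lambda>b\<in>tuples k (p - 1).
     \<Sum>a\<in>tuples k p. \<Sum>i=1..nat p.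
       (-1) ^ (i + 1) * (if b = remove_coord i a then 1 else 0) * coadjacency \<Lambda> (coord a i) * m a)"

definition evans_homology ::
    "nat \<Rightarrow> ('o, 'm) kgraph \<Rightarrow> int \<Rightarrow> (nat list \<Rightarrow> int) set monoid" where
  "evans_homology k \<Lambda> p =
     subgroup_generated (evans_chain k p)
       (kernel (evans_chain k p) (evans_chain k (p - 1)) (evans_diff k \<Lambda> p))
     Mod (evans_diff k \<Lambda> (p + 1) ` carrier (evans_chain k (p + 1)))"


section \<open>The second page of the Kasparov--Schochet spectral sequence\<close>

text \<open>The groups on the \<open>E\<^sup>2\<close> page matter only up to isomorphism, and by Evans they are the
  homology groups of the complex above in even rows and zero elsewhere. A bigraded abelian group
  is taken to be the \<open>E\<^sup>2\<close> page when it has this form; the \<open>C\<close>*-algebra of \<open>\<Lambda>\<close>, its K-theory and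
  the construction of the spectral sequence are not formalized.\<close>

definition kasparov_schochet_E2 ::
    "nat \<Rightarrow> ('o, 'm) kgraph \<Rightarrow> (int \<Rightarrow> int \<Rightarrow> 'e monoid) \<Rightarrow> bool" where
  "kasparov_schochet_E2 k \<Lambda> E \<longleftrightarrow>
     (\<forall>p q. comm_group (E p q) \<and>
        (if 0 \<le> p \<and> p \<le> int k \<and> even q
         then E p q \<cong> evans_homology k \<Lambda> p
         else trivial_group (E p q)))"

end

theory Submission
  imports Defs
begin

text \<open>
  The Evans complex of a monoid \<open>k\<close>-graph is the Koszul complex of the integers
  \<open>B\<^sub>1, \<dots>, B\<^sub>k\<close>. Write \<open>B\<^sub>i = g B'\<^sub>i\<close>; as \<open>g\<close> is the greatest common divisor
  and is nonzero, Bezout gives integers \<open>u\<^sub>i\<close> with \<open>\<Sum> u\<^sub>i B'\<^sub>i = 1\<close>. Let \<open>\<partial>'\<close> be the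
  Koszul differential of the \<open>B'\<^sub>i\<close>, so that the Evans differential is \<open>\<partial> = g \<partial>'\<close>. Exterior
  multiplication \<open>h\<close> by \<open>\<Sum> u\<^sub>i e\<^sub>i\<close> satisfies \<open>\<partial>' h + h \<partial>' = 1\<close>
  (\<open>koszul_homotopy\<close>), hence the complex of \<open>\<partial>'\<close> is exact. With \<open>Z\<^sub>p = ker \<partial>'\<^sub>p\<close> this says
  \<open>ker \<partial>\<^sub>p = Z\<^sub>p\<close> and \<open>im \<partial>\<^sub>p\<^sub>+\<^sub>1 = g Z\<^sub>p\<close> (\<open>koszul_cycles_scale\<close> and
  \<open>koszul_boundaries_scale\<close>), so the homology in degree \<open>p\<close> is \<open>Z\<^sub>p / g Z\<^sub>p\<close>.

  It remains to see that \<open>Z\<^sub>p\<close> is free of rank \<open>k - 1 choose p\<close> (\<open>koszul_cycles_free\<close>). It is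
  free as a subgroup of a finitely generated free abelian group
  (\<open>subgroup_of_int_functions_free\<close>). The homotopy splits the surjection
  \<open>\<partial>'\<close> from the chains of degree \<open>p + 1\<close> onto \<open>Z\<^sub>p\<close>, so the ranks of \<open>Z\<^sub>p\<^sub>+\<^sub>1\<close> and \<open>Z\<^sub>p\<close>
  add up to \<open>k choose (p + 1)\<close>, and Pascal's rule determines them by induction. Reducing
  coordinates on \<open>Z\<^sub>p\<close> modulo \<open>g\<close> then identifies the homology by the first isomorphism
  theorem (\<open>evans_homology_iso\<close>).
\<close>

section \<open>Finitely generated free abelian groups\<close>

text \<open>Free abelian groups are handled as sets of integer-valued functions closed under integer
  combinations. Functions vanish outside the index set instead of being undefined there, so that
  addition is pointwise and needs no restriction.\<close>

definition int_functions :: "'a set \<Rightarrow> ('a \<Rightarrow> int) set" where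
  "int_functions J = {x. \<forall>i. x i \<noteq> 0 \<longrightarrow> i \<in> J}"

definition int_closed :: "('a \<Rightarrow> int) set \<Rightarrow> bool" where
  "int_closed Z \<longleftrightarrow> (\<lambda>_. 0) \<in> Z \<and> (\<forall>x\<in>Z. \<forall>y\<in>Z. \<forall>a b. (\<lambda>i. a * x i + b * y i) \<in> Z)"

definition int_linear_on :: "('a \<Rightarrow> int) set \<Rightarrow> (('a \<Rightarrow> int) \<Rightarrow> 'b \<Rightarrow> int) \<Rightarrow> bool" where
  "int_linear_on Z f \<longleftrightarrow> (\<forall>x\<in>Z. \<forall>y\<in>Z. \<forall>a b.
     f (\<lambda>i. a * x i + b * y i) = (\<lambda>j. a * f x j + b * f y j))"

text \<open>The function \<open>c\<close> consists of the coordinates with respect to a basis with \<open>r\<close>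
  elements; \<open>int_functions {..<r}\<close> is a copy of \<open>\<int>\<^sup>r\<close>.\<close>

definition free_of_rank :: "('a \<Rightarrow> int) set \<Rightarrow> nat \<Rightarrow> bool" where
  "free_of_rank Z r \<longleftrightarrow> (\<exists>c. int_linear_on Z c \<and> bij_betw c Z (int_functions {..<r}))"

lemma int_functionsI: "(\<And>i. x i \<noteq> 0 \<Longrightarrow> i \<in> J) \<Longrightarrow> x \<in> int_functions J"
  by (simp add: int_functions_def)

lemma int_functions_zero: "x \<in> int_functions J \<Longrightarrow> i \<notin> J \<Longrightarrow> x i = 0"
  by (auto simp: int_functions_def)

lemma int_functions_empty: "int_functions {} = {\<lambda>_. 0}"
  by (auto simp: int_functions_def)

lemma int_functions_remove:
  assumes "x \<in> int_functions (insert i J)" "x i = 0"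
  shows "x \<in> int_functions J"
proof (rule int_functionsI)
  fix l assume "x l \<noteq> 0"
  then show "l \<in> J"
    using assms(2) int_functions_zero[OF assms(1), of l] by (cases "l = i") auto
qed

lemma int_closed_zero: "int_closed Z \<Longrightarrow> (\<lambda>_. 0) \<in> Z"
  and int_closed_comb: "int_closed Z \<Longrightarrow> x \<in> Z \<Longrightarrow> y \<in> Z \<Longrightarrow> (\<lambda>i. a * x i + b * y i) \<in> Z"
  by (auto simp: int_closed_def)

lemma int_linear_onD:
  "int_linear_on Z f \<Longrightarrow> x \<in> Z \<Longrightarrow> y \<in> Z
     \<Longrightarrow> f (\<lambda>i. a * x i + b * y i) = (\<lambda>j. a * f x j + b * f y j)"
  by (simp add: int_linear_on_def)

lemma int_linear_on_zero:
  assumes "int_linear_on Z f" "int_closed Z"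
  shows "f (\<lambda>_. 0) = (\<lambda>_. 0)"
  using int_linear_onD[OF assms(1) int_closed_zero int_closed_zero, of 0 0] assms(2) by simp

lemma int_linear_on_scale:
  assumes "int_linear_on Z f" "x \<in> Z"
  shows "f (\<lambda>i. a * x i) = (\<lambda>j. a * f x j)"
  using int_linear_onD[OF assms assms(2), of a 0] by simp

lemma int_closed_scale: "int_closed Z \<Longrightarrow> x \<in> Z \<Longrightarrow> (\<lambda>i. a * x i) \<in> Z"
  using int_closed_comb[of Z x x a 0] by simp

lemma int_closed_int_functions: "int_closed (int_functions J)"
  unfolding int_closed_def
proof (intro conjI ballI allI)
  fix x y a b assume "x \<in> int_functions J" "y \<in> int_functions J"
  then show "(\<lambda>i. a * x i + b * y i) \<in> int_functions J"
    by (intro int_functionsI) (metis add_0 int_functions_zero mult_zero_right)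
qed (simp add: int_functions_def)

lemma int_closed_kernel:
  assumes "int_closed Z" "int_linear_on Z f"
  shows "int_closed {x \<in> Z. f x = (\<lambda>_. 0)}"
  using assms int_linear_on_zero[OF assms(2,1)]
  by (auto simp: int_closed_def int_linear_on_def)

lemma int_linear_on_inverse:
  assumes Z: "int_closed Z" and lin: "int_linear_on Z f" and bij: "bij_betw f Z W"
  shows "int_linear_on W (the_inv_into Z f)"
proof -
  have inj: "inj_on f Z" and img: "f ` Z = W"
    using bij by (auto simp: bij_betw_def)
  show ?thesis
    unfolding int_linear_on_def
  proof (intro ballI allI)
    fix x y a b assume "x \<in> W" "y \<in> W"
    then obtain x' y' where "x = f x'" "x' \<in> Z" "y = f y'" "y' \<in> Z"
      using img by blast
    then show "the_inv_into Z f (\<lambda>i. a * x i + b * y i)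
        = (\<lambda>j. a * the_inv_into Z f x j + b * the_inv_into Z f y j)"
      using int_linear_onD[OF lin, of x' y' a b, symmetric]
      by (simp add: the_inv_into_f_f[OF inj] int_closed_comb[OF Z])
  qed
qed

text \<open>An isomorphism of free abelian groups induces one of their quotients modulo \<open>2\<close>. Representing
  the classes by indicator functions of subsets gives an injection between the power sets of the
  two index sets, so comparing cardinalities bounds the rank.\<close>

lemma card_le_if_int_functions_bij:
  fixes f :: "('a \<Rightarrow> int) \<Rightarrow> 'b \<Rightarrow> int"
  assumes "finite I" "finite J" and lin: "int_linear_on (int_functions I) f"
    and bij: "bij_betw f (int_functions I) (int_functions J)"
  shows "card I \<le> card J"
proof -
  let ?ind = "\<lambda>A i. (if i \<in> A then 1 else 0) :: int"
  let ?par = "\<lambda>A. {j. odd (f (?ind A) j)}"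
  have inj: "inj_on f (int_functions I)" and img: "f ` int_functions I = int_functions J"
    using bij by (auto simp: bij_betw_def)
  have mem: "?ind A \<in> int_functions I" if "A \<subseteq> I" for A
    using that by (auto simp: int_functions_def)
  have "inj_on ?par (Pow I)"
  proof (rule inj_onI)
    fix A Y assume XY: "A \<in> Pow I" "Y \<in> Pow I" "?par A = ?par Y"
    \<comment> \<open>If the images agree modulo \<open>2\<close>, the difference \<open>d\<close> of the indicators has an image
        divisible by \<open>2\<close>, so \<open>d\<close> itself is divisible by \<open>2\<close>.\<close>
    define d where "d = (\<lambda>i. 1 * ?ind A i + (-1) * ?ind Y i)"
    have d: "d \<in> int_functions I"
      unfolding d_def using XY by (intro int_closed_comb int_closed_int_functions mem) auto
    have fd: "f d = (\<lambda>j. 1 * f (?ind A) j + (-1) * f (?ind Y) j)"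
      unfolding d_def using XY by (intro int_linear_onD[OF lin] mem) auto
    define w where "w = (\<lambda>j. f d j div 2)"
    have "even (f d j)" for j
      using XY(3) by (auto simp: fd set_eq_iff)
    then have fw: "f d = (\<lambda>j. 2 * w j)"
      by (simp add: w_def)
    have "f d \<in> int_functions J"
      using d img by blast
    then have "w \<in> int_functions J"
      by (auto simp: fw int_functions_def)
    then obtain v where v: "v \<in> int_functions I" "f v = w"
      using img by (metis imageE)
    have "f (\<lambda>i. 2 * v i) = f d"
      using int_linear_on_scale[OF lin v(1), of 2] v(2) fw by simp
    then have "(\<lambda>i. 2 * v i) = d"
      using inj d v(1) int_closed_scale[OF int_closed_int_functions v(1), of 2]
      by (meson inj_onD)
    then have ev: "even (d i)" for i
      by (metis dvd_triv_left)
    have "i \<in> A \<longleftrightarrow> i \<in> Y" for i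
      using ev[of i] by (cases "i \<in> A"; cases "i \<in> Y"; simp add: d_def)
    then show "A = Y" by blast
  qed
  moreover have "?par ` Pow I \<subseteq> Pow J"
  proof clarify
    fix A j assume "A \<subseteq> I" and odd: "odd (f (?ind A) j)"
    then have "f (?ind A) \<in> int_functions J"
      using img mem by blast
    then show "j \<in> J"
      using odd int_functions_zero by fastforce
  qed
  ultimately have "card (Pow I) \<le> card (Pow J)"
    by (rule card_inj_on_le) (simp add: \<open>finite J\<close>)
  then show ?thesis
    using \<open>finite I\<close> \<open>finite J\<close> by (simp add: card_Pow)
qed

lemma free_of_rank_int_functions:
  assumes "finite J"
  shows "free_of_rank (int_functions J) (card J)"
proof -
  obtain e where e: "bij_betw e {..<card J} J"
    using ex_bij_betw_nat_finite[OF assms] by (auto simp: atLeast0LessThan)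
  define c where "c = (\<lambda>x n. if n < card J then x (e n) else 0 :: int)"
  have lin: "int_linear_on (int_functions J) c"
    by (auto simp: int_linear_on_def c_def)
  have "inj_on c (int_functions J)"
  proof (rule inj_onI, rule ext)
    fix x y i assume *: "x \<in> int_functions J" "y \<in> int_functions J" "c x = c y"
    show "x i = y i"
    proof (cases "i \<in> J")
      case True
      then obtain n where "n < card J" "e n = i"
        using e by (metis bij_betw_imp_surj_on imageE lessThan_iff)
      then show ?thesis using fun_cong[OF *(3), of n] by (simp add: c_def)
    next
      case False
      then show ?thesis using int_functions_zero[OF *(1)] int_functions_zero[OF *(2)] by simp
    qed
  qed
  moreover have "c ` int_functions J = int_functions {..<card J}"
  proof (intro equalityI subsetI)
    fix w :: "nat \<Rightarrow> int" assume w: "w \<in> int_functions {..<card J}"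
    let ?x = "\<lambda>i. if i \<in> J then w (the_inv_into {..<card J} e i) else 0"
    have w0: "w n = 0" if "\<not> n < card J" for n
      using int_functions_zero[OF w] that by simp
    have eq: "c ?x = w"
    proof
      fix n
      show "c ?x n = w n"
        using e w0[of n] by (auto simp: c_def bij_betw_def the_inv_into_f_f)
    qed
    have mem: "?x \<in> int_functions J"
      by (rule int_functionsI) (auto split: if_splits)
    show "w \<in> c ` int_functions J"
      using imageI[OF mem, of c] unfolding eq .
  next
    fix w assume "w \<in> c ` int_functions J"
    then obtain x where w: "w = c x" by (rule imageE)
    have "i < card J" if "c x i \<noteq> 0" for i
      using that unfolding c_def by presburger
    then have "c x \<in> int_functions {..<card J}"
      by (intro int_functionsI) simp
    then show "w \<in> int_functions {..<card J}"
      unfolding w .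
  qed
  ultimately show ?thesis
    using lin unfolding free_of_rank_def bij_betw_def by blast
qed

lemma free_of_rank_int_functions_unique:
  assumes "finite J" "free_of_rank (int_functions J) r"
  shows "r = card J"
proof -
  obtain c where c: "int_linear_on (int_functions J) c"
      "bij_betw c (int_functions J) (int_functions {..<r})"
    using assms(2) unfolding free_of_rank_def by blast
  have "card J \<le> card {..<r}"
    by (rule card_le_if_int_functions_bij[OF assms(1) _ c]) simp
  moreover have "card {..<r} \<le> card J"
    by (rule card_le_if_int_functions_bij[OF _ assms(1)
          int_linear_on_inverse[OF int_closed_int_functions c] bij_betw_the_inv_into[OF c(2)]]) simp
  ultimately show ?thesis by (simp only: card_lessThan)
qed

text \<open>A surjection \<open>f\<close> with a section \<open>h\<close> splits its source into the kernel of \<open>f\<close> and a copy of its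
  target: \<open>x\<close> corresponds to the pair of \<open>x - h (f x)\<close> and \<open>f x\<close>, and concatenating coordinates of
  both components gives coordinates of \<open>x\<close>.\<close>

lemma free_of_rank_split:
  assumes A: "int_closed A"
    and f: "int_linear_on A f" "f ` A \<subseteq> Y" and h: "int_linear_on Y h" "h ` Y \<subseteq> A"
    and fh: "\<And>y. y \<in> Y \<Longrightarrow> f (h y) = y"
    and rk: "free_of_rank {x \<in> A. f x = (\<lambda>_. 0)} r" "free_of_rank Y s"
  shows "free_of_rank A (r + s)"
proof -
  let ?K = "{x \<in> A. f x = (\<lambda>_. 0)}"
  obtain cK where cK: "int_linear_on ?K cK" "bij_betw cK ?K (int_functions {..<r})"
    using rk(1) unfolding free_of_rank_def by blast
  obtain cY where cY: "int_linear_on Y cY" "bij_betw cY Y (int_functions {..<s})"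
    using rk(2) unfolding free_of_rank_def by blast
  \<comment> \<open>The projection onto the kernel; the explicit coefficients make it an instance of the closure
    condition.\<close>
  define q where "q = (\<lambda>x i. 1 * x i + (-1) * h (f x) i)"
  have fA: "f x \<in> Y" and hfA: "h (f x) \<in> A" if "x \<in> A" for x
    using that f h by auto
  have qK: "q x \<in> ?K" if x: "x \<in> A" for x
  proof -
    have "f (q x) = (\<lambda>j. 1 * f x j + (-1) * f (h (f x)) j)"
      unfolding q_def by (rule int_linear_onD[OF f(1) x hfA[OF x]])
    then show ?thesis
      using int_closed_comb[OF A x hfA[OF x], of 1 "-1"] fh[OF fA[OF x]] by (simp add: q_def)
  qed
  have q_lin: "q (\<lambda>i. a * x i + b * y i) = (\<lambda>i. a * q x i + b * q y i)"
    if "x \<in> A" "y \<in> A" for x y a b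
    unfolding q_def int_linear_onD[OF f(1) that] int_linear_onD[OF h(1) fA[OF that(1)] fA[OF that(2)]]
    by (simp add: algebra_simps)
  define c where "c = (\<lambda>x n. if n < r then cK (q x) n else cY (f x) (n - r))"
  have cKr: "cK x n = 0" if "x \<in> ?K" "n \<ge> r" for x n
  proof -
    have "cK x \<in> int_functions {..<r}"
      using bij_betw_apply[OF cK(2) that(1)] .
    then show ?thesis using that(2) int_functions_zero by fastforce
  qed
  have cYs: "cY y \<in> int_functions {..<s}" if "y \<in> Y" for y
    using bij_betw_apply[OF cY(2) that] .
  have "int_linear_on A c"
    unfolding int_linear_on_def c_def
  proof (intro ballI allI ext)
    fix x y a b n assume x: "x \<in> A" and y: "y \<in> A"
    show "(if n < r then cK (q (\<lambda>i. a * x i + b * y i)) n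
           else cY (f (\<lambda>i. a * x i + b * y i)) (n - r))
        = a * (if n < r then cK (q x) n else cY (f x) (n - r))
          + b * (if n < r then cK (q y) n else cY (f y) (n - r))"
      unfolding q_lin[OF x y] int_linear_onD[OF f(1) x y]
        int_linear_onD[OF cK(1) qK[OF x] qK[OF y]] int_linear_onD[OF cY(1) fA[OF x] fA[OF y]]
      by simp
  qed
  moreover have "inj_on c A"
  proof (rule inj_onI)
    fix x y assume xy: "x \<in> A" "y \<in> A" "c x = c y"
    have "cK (q x) n = cK (q y) n" for n
      using fun_cong[OF xy(3), of n] cKr[OF qK[OF xy(1)], of n] cKr[OF qK[OF xy(2)], of n]
      by (cases "n < r") (simp_all add: c_def)
    then have "q x = q y"
      by (intro inj_onD[OF bij_betw_imp_inj_on[OF cK(2)] _ qK qK] xy(1,2) ext)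
    then have eq1: "q x i = q y i" for i
      by (rule fun_cong)
    have "cY (f x) n = cY (f y) n" for n
      using fun_cong[OF xy(3), of "n + r"] by (simp add: c_def)
    then have eq2: "f x = f y"
      by (intro inj_onD[OF bij_betw_imp_inj_on[OF cY(2)] _ fA fA] xy(1,2) ext)
    have "x i = y i" for i
      using eq1[of i] unfolding q_def eq2 by simp
    then show "x = y" by (rule ext)
  qed
  moreover have "c ` A = int_functions {..<r + s}"
  proof (intro equalityI subsetI)
    fix w assume "w \<in> c ` A"
    then obtain x where x: "w = c x" "x \<in> A" by (rule imageE)
    show "w \<in> int_functions {..<r + s}"
    proof (rule int_functionsI)
      fix n assume "w n \<noteq> 0"
      then have "n < r \<or> cY (f x) (n - r) \<noteq> 0"
        unfolding x(1) c_def by presburger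
      then show "n \<in> {..<r + s}"
        using int_functions_zero[OF cYs[OF fA[OF x(2)]], of "n - r"] by force
    qed
  next
    fix w :: "nat \<Rightarrow> int" assume w: "w \<in> int_functions {..<r + s}"
    have "(\<lambda>n. if n < r then w n else 0) \<in> int_functions {..<r}"
      by (rule int_functionsI) (simp split: if_splits)
    then obtain a where a: "a \<in> ?K" "cK a = (\<lambda>n. if n < r then w n else 0)"
      using bij_betw_imp_surj_on[OF cK(2)] by (metis (no_types, lifting) imageE)
    have "(\<lambda>n. w (n + r)) \<in> int_functions {..<s}"
      using int_functions_zero[OF w] by (intro int_functionsI) force
    then obtain y where y: "y \<in> Y" "cY y = (\<lambda>n. w (n + r))"
      using cY(2) by (metis (no_types, lifting) bij_betw_imp_surj_on imageE)
    define x where "x = (\<lambda>i. 1 * a i + 1 * h y i)"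
    have hy: "h y \<in> A" using h y by auto
    have xA: "x \<in> A"
      unfolding x_def using a hy by (intro int_closed_comb[OF A]) auto
    have "f x = (\<lambda>j. 1 * f a j + 1 * f (h y) j)"
      unfolding x_def using a hy by (intro int_linear_onD[OF f(1)]) auto
    then have fx: "f x = y"
      using a fh[OF y(1)] by simp
    have "q x = a"
      unfolding q_def fx by (simp add: x_def)
    then have "c x n = w n" for n
      using fun_cong[OF a(2), of n] fun_cong[OF y(2), of "n - r"] fx by (simp add: c_def)
    then have "w = c x" by (intro ext) simp
    then show "w \<in> c ` A" using xA by (rule image_eqI)
  qed
  ultimately show ?thesis
    unfolding free_of_rank_def bij_betw_def by blast
qed

text \<open>The least positive element divides every other one by division with remainder.\<close>

lemma int_subgroup_generator:
  fixes E :: "int set"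
  assumes zero: "0 \<in> E" and comb: "\<And>x y a b. x \<in> E \<Longrightarrow> y \<in> E \<Longrightarrow> a * x + b * y \<in> E"
  shows "\<exists>d\<in>E. \<forall>e\<in>E. d dvd e"
proof (cases "\<exists>e\<in>E. e \<noteq> 0")
  case True
  then obtain e where e: "e \<in> E" "e \<noteq> 0" by blast
  let ?P = "\<lambda>n. int n \<in> E \<and> 0 < n"
  have "sgn e * e + 0 * e = int (nat \<bar>e\<bar>)"
    by (simp add: sgn_if)
  then have P: "?P (nat \<bar>e\<bar>)"
    using comb[OF e(1) e(1), of "sgn e" 0] e(2) by simp
  define d where "d = (LEAST n. ?P n)"
  have d: "int d \<in> E" "0 < d"
    using LeastI[of ?P, OF P] unfolding d_def by simp_all
  have least: "d \<le> n" if "?P n" for n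
    unfolding d_def using that by (rule Least_le)
  have "int d dvd x" if x: "x \<in> E" for x
  proof -
    have "x mod int d \<in> E"
      using comb[OF x d(1), of 1 "- (x div int d)"] by (simp add: minus_div_mult_eq_mod[symmetric])
    moreover have range: "0 \<le> x mod int d" "x mod int d < int d"
      using d(2) by simp_all
    ultimately have "0 < nat (x mod int d) \<Longrightarrow> d \<le> nat (x mod int d)"
      by (intro least) simp
    then have "x mod int d = 0"
      using range by linarith
    then show ?thesis
      by (simp only: dvd_eq_mod_eq_0)
  qed
  then show ?thesis using d(1) by blast
next
  case False
  then show ?thesis using zero by (intro bexI[of _ 0]) auto
qed

text \<open>Induction on the number of coordinates: evaluation at a new coordinate \<open>i\<close> maps the subgroup
  onto the multiples of some \<open>z\<^sub>0 i\<close> with \<open>z\<^sub>0\<close> in the subgroup. Either this is zero, or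
  \<open>z\<^sub>0\<close> provides a section, and the subgroup splits into an infinite cyclic group and
  the elements vanishing at \<open>i\<close>.\<close>

lemma subgroup_of_int_functions_free:
  assumes "finite J" "int_closed Z" "Z \<subseteq> int_functions J"
  shows "\<exists>r. free_of_rank Z r"
  using assms
proof (induction J arbitrary: Z rule: finite_induct)
  case empty
  then have "Z = int_functions {}"
    using int_closed_zero[of Z] by (auto simp: int_functions_empty)
  then show ?case
    using free_of_rank_int_functions[OF finite.emptyI] by blast
next
  case (insert i J Z)
  note Z = insert.prems(1)
  have "\<exists>d\<in>(\<lambda>z. z i) ` Z. \<forall>e\<in>(\<lambda>z. z i) ` Z. d dvd e"
  proof (rule int_subgroup_generator)
    show "0 \<in> (\<lambda>z. z i) ` Z"
      using int_closed_zero[OF Z] by (rule rev_image_eqI) simp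
    fix x y a b assume "x \<in> (\<lambda>z. z i) ` Z" "y \<in> (\<lambda>z. z i) ` Z"
    then obtain v w where vw: "v \<in> Z" "w \<in> Z" and eq: "x = v i" "y = w i"
      by (elim imageE)
    show "a * x + b * y \<in> (\<lambda>z. z i) ` Z"
      unfolding eq using int_closed_comb[OF Z vw, of a b] by (rule rev_image_eqI) simp
  qed
  then obtain z0 where z0: "z0 \<in> Z" and dvd: "\<And>z. z \<in> Z \<Longrightarrow> z0 i dvd z i"
    by (elim bexE imageE) simp
  show ?case
  proof (cases "z0 i = 0")
    case True
    have "Z \<subseteq> int_functions J"
    proof
      fix z assume z: "z \<in> Z"
      have "z i = 0"
        using dvd[OF z] True by simp
      then show "z \<in> int_functions J"
        by (rule int_functions_remove[OF subsetD[OF insert.prems(2) z]])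
    qed
    then show ?thesis
      by (rule insert.IH[OF Z])
  next
    case False
    define f where "f = (\<lambda>(z :: 'a \<Rightarrow> int) (_ :: unit). z i div z0 i)"
    define h where "h = (\<lambda>(y :: unit \<Rightarrow> int) j. y () * z0 j)"
    have f: "int_linear_on Z f"
      unfolding int_linear_on_def f_def
    proof (intro ballI allI ext)
      fix x y a b assume xy: "x \<in> Z" "y \<in> Z"
      obtain m where m: "x i = z0 i * m" using dvd[OF xy(1)] by (rule dvdE)
      obtain n where n: "y i = z0 i * n" using dvd[OF xy(2)] by (rule dvdE)
      have "a * x i + b * y i = z0 i * (a * m + b * n)"
        unfolding m n by (simp add: algebra_simps)
      then show "(a * x i + b * y i) div z0 i = a * (x i div z0 i) + b * (y i div z0 i)"
        using False m n by simp
    qed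
    have h: "int_linear_on (int_functions UNIV) h"
      unfolding int_linear_on_def h_def by (intro ballI allI ext) (simp add: algebra_simps)
    have ker: "{x \<in> Z. f x = (\<lambda>_. 0)} \<subseteq> int_functions J"
    proof
      fix x assume "x \<in> {x \<in> Z. f x = (\<lambda>_. 0)}"
      then have x: "x \<in> Z" and fx: "f x = (\<lambda>_. 0)" by simp_all
      have "x i div z0 i = 0"
        using fun_cong[OF fx, of "()"] by (simp add: f_def)
      then have "x i = 0"
        using dvd_mult_div_cancel[OF dvd[OF x]] by simp
      then show "x \<in> int_functions J"
        by (rule int_functions_remove[OF subsetD[OF insert.prems(2) x]])
    qed
    obtain r where r: "free_of_rank {x \<in> Z. f x = (\<lambda>_. 0)} r"
      using insert.IH[OF int_closed_kernel[OF Z f] ker] by (rule exE)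
    have "free_of_rank Z (r + card (UNIV :: unit set))"
    proof (rule free_of_rank_split[OF Z f _ h _ _ r free_of_rank_int_functions[OF finite_UNIV]])
      show "f ` Z \<subseteq> int_functions UNIV"
        by (simp add: int_functions_def)
      show "h ` int_functions UNIV \<subseteq> Z"
        unfolding h_def using int_closed_scale[OF Z z0] by (intro image_subsetI)
      show "f (h y) = y" for y
        using False by (simp add: f_def h_def)
    qed
    then show ?thesis by (rule exI)
  qed
qed

section \<open>The Koszul complex of a family of integers\<close>

text \<open>The sign acquired when \<open>e\<^sub>i\<close> is moved to its place in the ordered wedge product of the
  elements of \<open>S\<close>.\<close>

definition before_sign :: "'a::linorder \<Rightarrow> 'a set \<Rightarrow> int" where
  "before_sign i S = (-1) ^ card {j \<in> S. j < i}"

text \<open>The exterior power of degree \<open>p\<close> of the free abelian group on \<open>V\<close>; a chain is given by its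
  coefficients at the wedge products of the subsets of \<open>V\<close>.\<close>

definition koszul_chains :: "'a set \<Rightarrow> nat \<Rightarrow> ('a set \<Rightarrow> int) set" where
  "koszul_chains V p = int_functions {S. S \<subseteq> V \<and> card S = p}"

text \<open>The Koszul differential, that is, interior multiplication with the linear form sending \<open>e\<^sub>i\<close>
  to \<open>B i\<close>, written through the coefficients of the result.\<close>

definition contract :: "'a::linorder set \<Rightarrow> ('a \<Rightarrow> int) \<Rightarrow> ('a set \<Rightarrow> int) \<Rightarrow> 'a set \<Rightarrow> int" where
  "contract V B x S = (\<Sum>i\<in>V - S. before_sign i S * B i * x (insert i S))"

text \<open>Exterior multiplication from the left by \<open>\<Sum> u\<^sub>i e\<^sub>i\<close>. Intersecting with \<open>V\<close> keeps the
  result supported on subsets of \<open>V\<close>.\<close>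

definition wedge :: "'a::linorder set \<Rightarrow> ('a \<Rightarrow> int) \<Rightarrow> ('a set \<Rightarrow> int) \<Rightarrow> 'a set \<Rightarrow> int" where
  "wedge V u x S = (\<Sum>i\<in>S \<inter> V. before_sign i (S - {i}) * u i * x (S - {i}))"

definition koszul_cycles :: "'a::linorder set \<Rightarrow> ('a \<Rightarrow> int) \<Rightarrow> nat \<Rightarrow> ('a set \<Rightarrow> int) set" where
  "koszul_cycles V B p = {x \<in> koszul_chains V p. contract V B x = (\<lambda>_. 0)}"

lemma before_sign_square: "before_sign i S * before_sign i S = 1"
  by (simp add: before_sign_def flip: power_add)

lemma before_sign_insert:
  assumes "finite S" "i \<notin> S"
  shows "before_sign j (insert i S) = (if i < j then - before_sign j S else before_sign j S)"
proof -
  have eq: "{l \<in> insert i S. l < j} = (if i < j then insert i {l \<in> S. l < j} else {l \<in> S. l < j})"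
    by auto
  have card: "card (insert i {l \<in> S. l < j}) = Suc (card {l \<in> S. l < j})"
    using assms by simp
  show ?thesis
    by (cases "i < j") (simp_all only: before_sign_def eq card if_True if_False power_Suc mult_minus1)
qed

lemma before_sign_insert_less:
    "finite S \<Longrightarrow> i \<notin> S \<Longrightarrow> i < j \<Longrightarrow> before_sign j (insert i S) = - before_sign j S"
  and before_sign_insert_greater:
    "finite S \<Longrightarrow> i \<notin> S \<Longrightarrow> j < i \<Longrightarrow> before_sign j (insert i S) = before_sign j S"
  using before_sign_insert[of S i j] by auto

text \<open>Of two distinct elements exactly one precedes the other, so exactly one of the two signs is
  changed by inserting the other element. This anticommutation is behind \<open>\<partial>\<partial> = 0\<close>, and its variant
  below makes the mixed terms of the homotopy cancel.\<close>

lemma before_sign_swap: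
  assumes "finite S" "i \<notin> S" "j \<notin> S" "i \<noteq> j"
  shows "before_sign i S * before_sign j (insert i S)
       = - (before_sign j S * before_sign i (insert j S))"
proof (cases "i < j")
  case True
  show ?thesis
    by (simp only: before_sign_insert_less[OF assms(1,2) True]
        before_sign_insert_greater[OF assms(1,3) True] mult_minus_right mult.commute)
next
  case False
  then have *: "j < i" using assms(4) by order
  show ?thesis
    by (simp only: before_sign_insert_less[OF assms(1,3) *]
        before_sign_insert_greater[OF assms(1,2) *] mult_minus_right mult.commute minus_minus)
qed

lemma before_sign_homotopy:
  assumes "finite S" "i \<notin> S" "j \<notin> S" "i \<noteq> j"
  shows "before_sign i (insert j S) * before_sign j (insert i S) = - (before_sign j S * before_sign i S)"
proof (cases "i < j")
  case True
  show ?thesis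
    by (simp only: before_sign_insert_less[OF assms(1,2) True]
        before_sign_insert_greater[OF assms(1,3) True] mult_minus_right mult.commute)
next
  case False
  then have *: "j < i" using assms(4) by order
  show ?thesis
    by (simp only: before_sign_insert_less[OF assms(1,3) *]
        before_sign_insert_greater[OF assms(1,2) *] mult_minus_left mult_minus_right mult.commute)
qed

lemma sum_antisymmetric:
  fixes F :: "'a \<Rightarrow> 'a \<Rightarrow> int"
  assumes "finite W" and anti: "\<And>i j. i \<in> W \<Longrightarrow> j \<in> W \<Longrightarrow> i \<noteq> j \<Longrightarrow> F i j = - F j i"
  shows "(\<Sum>i\<in>W. \<Sum>j\<in>W - {i}. F i j) = 0"
proof -
  let ?G = "\<lambda>i j. if i = j then 0 else F i j"
  have eq: "(\<Sum>i\<in>W. \<Sum>j\<in>W - {i}. F i j) = (\<Sum>i\<in>W. \<Sum>j\<in>W. ?G i j)"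
  proof (rule sum.cong[OF refl])
    fix i assume "i \<in> W"
    show "(\<Sum>j\<in>W - {i}. F i j) = (\<Sum>j\<in>W. ?G i j)"
      using \<open>finite W\<close> by (intro sum.mono_neutral_cong_left) auto
  qed
  have "(\<Sum>i\<in>W. \<Sum>j\<in>W. ?G i j) = (\<Sum>i\<in>W. \<Sum>j\<in>W. - ?G j i)"
  proof (intro sum.cong refl)
    fix i j assume "i \<in> W" "j \<in> W"
    then show "?G i j = - ?G j i"
      by (cases "i = j") (simp_all add: anti[of i j])
  qed
  also have "\<dots> = - (\<Sum>i\<in>W. \<Sum>j\<in>W. ?G j i)"
    by (simp add: sum_negf)
  also have "(\<Sum>i\<in>W. \<Sum>j\<in>W. ?G j i) = (\<Sum>i\<in>W. \<Sum>j\<in>W. ?G i j)"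
    by (rule sum.swap)
  finally have "(\<Sum>i\<in>W. \<Sum>j\<in>W. ?G i j) = 0"
    by linarith
  then show ?thesis
    by (simp only: eq)
qed

lemma koszul_chains_zero:
  "x \<in> koszul_chains V p \<Longrightarrow> \<not> (S \<subseteq> V \<and> card S = p) \<Longrightarrow> x S = 0"
  unfolding koszul_chains_def by (rule int_functions_zero[of x "{S. S \<subseteq> V \<and> card S = p}" S]) simp_all

lemma koszul_chains_nonzero:
  assumes "x \<in> koszul_chains V p" "x S \<noteq> 0"
  shows "S \<subseteq> V" "card S = p"
  using koszul_chains_zero[OF assms(1), of S] assms(2) by blast+

lemma koszul_chainsI:
  "(\<And>S. x S \<noteq> 0 \<Longrightarrow> S \<subseteq> V \<and> card S = p) \<Longrightarrow> x \<in> koszul_chains V p"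
  unfolding koszul_chains_def by (rule int_functionsI) simp

lemma int_closed_koszul_chains: "int_closed (koszul_chains V p)"
  by (simp add: koszul_chains_def int_closed_int_functions)

lemma int_linear_on_contract: "int_linear_on Z (contract V B)"
  unfolding int_linear_on_def contract_def
  by (intro ballI allI ext) (simp add: sum_distrib_left sum.distrib algebra_simps)

lemma int_linear_on_wedge: "int_linear_on Z (wedge V u)"
  unfolding int_linear_on_def wedge_def
  by (intro ballI allI ext) (simp add: sum_distrib_left sum.distrib algebra_simps)

lemma int_closed_koszul_cycles: "int_closed (koszul_cycles V B p)"
  unfolding koszul_cycles_def
  by (intro int_closed_kernel int_closed_koszul_chains int_linear_on_contract)

lemma contract_in_koszul_chains:
  assumes "finite V" "x \<in> koszul_chains V (Suc p)"
  shows "contract V B x \<in> koszul_chains V p"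
proof (rule koszul_chainsI)
  fix S assume "contract V B x S \<noteq> 0"
  then obtain i where i: "i \<in> V - S" "before_sign i S * B i * x (insert i S) \<noteq> 0"
    unfolding contract_def by (rule sum.not_neutral_contains_not_neutral)
  then have nz: "x (insert i S) \<noteq> 0" by simp
  have SV: "S \<subseteq> V"
    using koszul_chains_nonzero(1)[OF assms(2) nz] by simp
  have "card (insert i S) = Suc (card S)"
    using i(1) finite_subset[OF SV assms(1)] by simp
  then show "S \<subseteq> V \<and> card S = p"
    using SV koszul_chains_nonzero(2)[OF assms(2) nz] by simp
qed

lemma wedge_in_koszul_chains:
  assumes "finite V" "x \<in> koszul_chains V p"
  shows "wedge V u x \<in> koszul_chains V (Suc p)"
proof (rule koszul_chainsI)
  fix S assume "wedge V u x S \<noteq> 0"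
  then obtain i where i: "i \<in> S \<inter> V" "before_sign i (S - {i}) * u i * x (S - {i}) \<noteq> 0"
    unfolding wedge_def by (rule sum.not_neutral_contains_not_neutral)
  then have nz: "x (S - {i}) \<noteq> 0" by simp
  have SV: "S \<subseteq> V"
    using koszul_chains_nonzero(1)[OF assms(2) nz] i(1) by blast
  have "card S = Suc (card (S - {i}))"
    using i(1) finite_subset[OF SV assms(1)] by (simp only: card_Suc_Diff1 IntD1)
  then show "S \<subseteq> V \<and> card S = Suc p"
    using SV koszul_chains_nonzero(2)[OF assms(2) nz] by simp
qed

lemma contract_degree_0:
  assumes "finite V" "x \<in> koszul_chains V 0"
  shows "contract V B x = (\<lambda>_. 0)"
proof
  fix S
  have "x (insert i S) = 0" if "i \<in> V" for i
  proof (rule ccontr)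
    assume nz: "x (insert i S) \<noteq> 0"
    have "finite (insert i S)"
      using koszul_chains_nonzero(1)[OF assms(2) nz] assms(1) by (rule finite_subset)
    then show False
      using koszul_chains_nonzero(2)[OF assms(2) nz] by simp
  qed
  then show "contract V B x S = 0"
    by (simp add: contract_def)
qed

text \<open>The terms for the ordered pairs \<open>(i, j)\<close> and \<open>(j, i)\<close> cancel.\<close>

lemma contract_contract:
  assumes V: "finite V" and x: "x \<in> koszul_chains V p"
  shows "contract V B (contract V B x) = (\<lambda>_. 0)"
proof
  fix S
  show "contract V B (contract V B x) S = 0"
  proof (cases "S \<subseteq> V")
    case True
    then have S: "finite S" using V finite_subset by blast
    let ?F = "\<lambda>i j. before_sign i S * B i *
      (before_sign j (insert i S) * B j * x (insert j (insert i S)))"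
    have "contract V B (contract V B x) S = (\<Sum>i\<in>V - S. \<Sum>j\<in>(V - S) - {i}. ?F i j)"
      unfolding contract_def sum_distrib_left
      by (intro sum.cong refl) auto
    also have "\<dots> = 0"
    proof (rule sum_antisymmetric)
      fix i j assume ij: "i \<in> V - S" "j \<in> V - S" "i \<noteq> j"
      have "?F i j = (before_sign i S * before_sign j (insert i S)) * (B i * B j * x (insert i (insert j S)))"
        by (simp add: insert_commute)
      also have "\<dots> = - ?F j i"
        using ij by (subst before_sign_swap[OF S]) (simp_all add: insert_commute)
      finally show "?F i j = - ?F j i" .
    qed (use V in simp)
    finally show ?thesis .
  next
    case False
    then have "x (insert j (insert i S)) = 0" for i j
      by (intro koszul_chains_zero[OF x]) simp
    then show ?thesis by (simp add: contract_def)
  qed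
qed

text \<open>The identity \<open>\<partial>h + h\<partial> = \<Sum> u\<^sub>i B\<^sub>i\<close>. Inserting and then removing the same index (or
  the other way round) contributes \<open>u\<^sub>i B\<^sub>i\<close>, for \<open>i\<close> outside \<open>S\<close> in the first summand and for
  \<open>i\<close> in \<open>S\<close> in the second; the terms with two distinct indices occur in both summands with
  opposite signs.\<close>

lemma koszul_homotopy:
  assumes V: "finite V" and SV: "S \<subseteq> V"
  shows "contract V B (wedge V u x) S + wedge V u (contract V B x) S = (\<Sum>i\<in>V. u i * B i) * x S"
proof -
  have S: "finite S" using V SV finite_subset by blast
  let ?W = "V - S"
  \<comment> \<open>The mixed terms of \<open>\<partial>h\<close> and of \<open>h\<partial>\<close>, with \<open>i\<close> outside \<open>S\<close> inserted and \<open>j\<close> in \<open>S\<close>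
    removed.\<close>
  let ?C = "\<lambda>i j. before_sign i S * B i *
    (before_sign j (insert i (S - {j})) * u j * x (insert i (S - {j})))"
  let ?D = "\<lambda>j i. before_sign j (S - {j}) * u j *
    (before_sign i (S - {j}) * B i * x (insert i (S - {j})))"
  have "contract V B (wedge V u x) S = (\<Sum>i\<in>?W. u i * B i * x S + (\<Sum>j\<in>S. ?C i j))"
    unfolding contract_def
  proof (rule sum.cong[OF refl])
    fix i assume i: "i \<in> ?W"
    have sp: "insert i S \<inter> V = insert i S" using i SV by auto
    have "wedge V u x (insert i S) = before_sign i S * u i * x S
        + (\<Sum>j\<in>S. before_sign j (insert i S - {j}) * u j * x (insert i S - {j}))"
      unfolding wedge_def sp using i S by simp
    also have "(\<Sum>j\<in>S. before_sign j (insert i S - {j}) * u j * x (insert i S - {j}))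
        = (\<Sum>j\<in>S. before_sign j (insert i (S - {j})) * u j * x (insert i (S - {j})))"
    proof (rule sum.cong[OF refl])
      fix j assume "j \<in> S"
      then have "insert i S - {j} = insert i (S - {j})" using i by auto
      then show "before_sign j (insert i S - {j}) * u j * x (insert i S - {j})
        = before_sign j (insert i (S - {j})) * u j * x (insert i (S - {j}))" by simp
    qed
    finally have "before_sign i S * B i * wedge V u x (insert i S)
      = (before_sign i S * before_sign i S) * (u i * B i * x S) + (\<Sum>j\<in>S. ?C i j)"
      by (simp add: algebra_simps sum_distrib_left)
    then show "before_sign i S * B i * wedge V u x (insert i S)
      = u i * B i * x S + (\<Sum>j\<in>S. ?C i j)"
      by (simp add: before_sign_square)
  qed
  moreover have "wedge V u (contract V B x) S = (\<Sum>j\<in>S. u j * B j * x S + (\<Sum>i\<in>?W. ?D j i))"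
    unfolding wedge_def
  proof (rule sum.cong)
    fix j assume j: "j \<in> S"
    have sp: "V - (S - {j}) = insert j ?W" using j SV by auto
    have "contract V B x (S - {j}) = before_sign j (S - {j}) * B j * x S
        + (\<Sum>i\<in>?W. before_sign i (S - {j}) * B i * x (insert i (S - {j})))"
      unfolding contract_def sp using j V by (simp add: insert_absorb)
    then have "before_sign j (S - {j}) * u j * contract V B x (S - {j})
      = (before_sign j (S - {j}) * before_sign j (S - {j})) * (u j * B j * x S) + (\<Sum>i\<in>?W. ?D j i)"
      by (simp add: algebra_simps sum_distrib_left)
    then show "before_sign j (S - {j}) * u j * contract V B x (S - {j})
      = u j * B j * x S + (\<Sum>i\<in>?W. ?D j i)"
      by (simp add: before_sign_square)
  qed (use SV in auto)
  moreover have "(\<Sum>j\<in>S. \<Sum>i\<in>?W. ?D j i) = - (\<Sum>i\<in>?W. \<Sum>j\<in>S. ?C i j)"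
  proof -
    have "?D j i = - ?C i j" if ij: "i \<in> ?W" "j \<in> S" for i j
    proof -
      have "before_sign i S * before_sign j (insert i (S - {j}))
          = - (before_sign j (S - {j}) * before_sign i (S - {j}))"
        using before_sign_homotopy[of "S - {j}" i j] ij S by (auto simp: insert_absorb)
      moreover have "?C i j = (before_sign i S * before_sign j (insert i (S - {j})))
          * (u j * B i * x (insert i (S - {j})))"
        by (simp only: ac_simps)
      moreover have "?D j i = (before_sign j (S - {j}) * before_sign i (S - {j}))
          * (u j * B i * x (insert i (S - {j})))"
        by (simp only: ac_simps)
      ultimately show ?thesis by (simp only: mult_minus_left minus_minus)
    qed
    then have "(\<Sum>i\<in>?W. \<Sum>j\<in>S. ?D j i) = - (\<Sum>i\<in>?W. \<Sum>j\<in>S. ?C i j)"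
      by (simp add: sum_negf)
    then show ?thesis
      using sum.swap[of ?D ?W S] by simp
  qed
  moreover have "(\<Sum>i\<in>?W. u i * B i * x S) + (\<Sum>i\<in>S. u i * B i * x S) = (\<Sum>i\<in>V. u i * B i) * x S"
    using sum.subset_diff[OF SV V, of "\<lambda>i. u i * B i * x S"] by (simp add: sum_distrib_right)
  ultimately show ?thesis
    by (simp add: sum.distrib)
qed

lemma koszul_exact:
  assumes V: "finite V" and uB: "(\<Sum>i\<in>V. u i * B i) = 1" and x: "x \<in> koszul_cycles V B p"
  shows "contract V B (wedge V u x) = x"
proof
  fix S
  have xc: "x \<in> koszul_chains V p" and x0: "contract V B x = (\<lambda>_. 0)"
    using x by (auto simp: koszul_cycles_def)
  show "contract V B (wedge V u x) S = x S"
  proof (cases "S \<subseteq> V")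
    case True
    then show ?thesis
      using koszul_homotopy[OF V True, of B u x] uB x0 by (simp add: wedge_def)
  next
    case False
    have "contract V B (wedge V u x) \<in> koszul_chains V p"
      by (intro contract_in_koszul_chains wedge_in_koszul_chains V xc)
    then show ?thesis
      using koszul_chains_zero[OF xc, of S] False koszul_chains_zero[of _ V p S] by simp
  qed
qed

lemma contract_in_koszul_cycles:
  assumes "finite V" "x \<in> koszul_chains V (Suc p)"
  shows "contract V B x \<in> koszul_cycles V B p"
  using contract_in_koszul_chains[OF assms] contract_contract[OF assms]
  by (simp add: koszul_cycles_def)

lemma free_of_rank_koszul_chains:
  "finite V \<Longrightarrow> free_of_rank (koszul_chains V p) (card V choose p)"
  using free_of_rank_int_functions[of "{S. S \<subseteq> V \<and> card S = p}"]
  by (simp add: koszul_chains_def n_subsets)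

text \<open>In degree \<open>0\<close> every chain is a cycle. For the step, the homotopy is a section of the
  differential from the chains of degree \<open>p + 1\<close> onto the cycles of degree \<open>p\<close>, so the number of
  subsets with \<open>p + 1\<close> elements is the sum of the ranks of the cycles in degrees \<open>p + 1\<close> and \<open>p\<close>.\<close>

lemma koszul_cycles_free:
  assumes V: "finite V" "V \<noteq> {}" and uB: "(\<Sum>i\<in>V. u i * B i) = 1"
  shows "free_of_rank (koszul_cycles V B p) ((card V - 1) choose p)"
proof (induction p)
  case 0
  have "koszul_cycles V B 0 = koszul_chains V 0"
    using contract_degree_0[OF V(1)] by (auto simp: koszul_cycles_def)
  then show ?case
    using free_of_rank_koszul_chains[OF V(1), of 0] by simp
next
  case (Suc p)
  have fin: "finite {S. S \<subseteq> V \<and> card S = Suc p}"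
    using V by simp
  obtain r where r: "free_of_rank (koszul_cycles V B (Suc p)) r"
    using subgroup_of_int_functions_free[OF fin int_closed_koszul_cycles, of V B "Suc p"]
    by (auto simp: koszul_cycles_def koszul_chains_def)
  have "free_of_rank (koszul_chains V (Suc p)) (r + ((card V - 1) choose p))"
  proof (rule free_of_rank_split)
    show "contract V B ` koszul_chains V (Suc p) \<subseteq> koszul_cycles V B p"
      using contract_in_koszul_cycles[OF V(1)] by blast
    show "wedge V u ` koszul_cycles V B p \<subseteq> koszul_chains V (Suc p)"
      using wedge_in_koszul_chains[OF V(1)] by (auto simp: koszul_cycles_def)
    show "free_of_rank {x \<in> koszul_chains V (Suc p). contract V B x = (\<lambda>_. 0)} r"
      using r by (simp add: koszul_cycles_def)
  qed (use Suc koszul_exact[OF V(1) uB] int_closed_koszul_chains int_linear_on_contract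
        int_linear_on_wedge in auto)
  then have "r + ((card V - 1) choose p) = card V choose Suc p"
    using free_of_rank_int_functions_unique[OF fin] V(1)
    by (simp add: koszul_chains_def n_subsets)
  moreover have "card V choose Suc p = ((card V - 1) choose p) + ((card V - 1) choose Suc p)"
    using V by (metis One_nat_def Suc_diff_1 binomial_Suc_Suc card_gt_0_iff)
  ultimately show ?case using r by simp
qed

lemma contract_scale:
  assumes "\<forall>i\<in>V. B i = g * B' i"
  shows "contract V B x = (\<lambda>S. g * contract V B' x S)"
proof
  fix S
  have "before_sign i S * B i * x (insert i S) = g * (before_sign i S * B' i * x (insert i S))"
    if "i \<in> V - S" for i
    using bspec[OF assms, of i] that by simp
  then show "contract V B x S = g * contract V B' x S"
    unfolding contract_def sum_distrib_left by (rule sum.cong[OF refl])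
qed

lemma koszul_cycles_scale:
  assumes "\<forall>i\<in>V. B i = g * B' i" "g \<noteq> 0"
  shows "koszul_cycles V B p = koszul_cycles V B' p"
  unfolding koszul_cycles_def contract_scale[OF assms(1)] using assms(2) by (simp add: fun_eq_iff)

text \<open>By exactness the boundaries for \<open>B'\<close> are all the cycles, and the differential for \<open>B\<close> is \<open>g\<close>
  times the one for \<open>B'\<close>.\<close>

lemma koszul_boundaries_scale:
  assumes V: "finite V" and uB: "(\<Sum>i\<in>V. u i * B' i) = 1"
    and B: "\<forall>i\<in>V. B i = g * B' i"
  shows "contract V B ` koszul_chains V (Suc p) = (\<lambda>z S. g * z S) ` koszul_cycles V B' p"
proof (intro equalityI subsetI)
  fix y assume "y \<in> contract V B ` koszul_chains V (Suc p)"
  then obtain x where x: "y = contract V B x" "x \<in> koszul_chains V (Suc p)"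
    by (rule imageE)
  show "y \<in> (\<lambda>z S. g * z S) ` koszul_cycles V B' p"
    unfolding x(1) contract_scale[OF B]
    using contract_in_koszul_cycles[OF V x(2)] by (rule rev_image_eqI) (rule refl)
next
  fix y assume "y \<in> (\<lambda>z S. g * z S) ` koszul_cycles V B' p"
  then obtain z where z: "y = (\<lambda>S. g * z S)" "z \<in> koszul_cycles V B' p"
    by (rule imageE)
  have "z \<in> koszul_chains V p"
    using z(2) by (simp add: koszul_cycles_def)
  then show "y \<in> contract V B ` koszul_chains V (Suc p)"
    by (intro image_eqI[where x = "wedge V u z"] wedge_in_koszul_chains V)
       (simp add: z(1) contract_scale[OF B] koszul_exact[OF V uB z(2)])
qed

lemma Gcd_int_linear_combination:
  fixes B :: "'a \<Rightarrow> int"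
  assumes "finite V"
  shows "\<exists>u. (\<Sum>i\<in>V. u i * B i) = Gcd (B ` V)"
  using assms
proof (induction V rule: finite_induct)
  case (insert i V)
  then obtain u where u: "(\<Sum>i\<in>V. u i * B i) = Gcd (B ` V)" by blast
  obtain s t where st: "s * B i + t * Gcd (B ` V) = gcd (B i) (Gcd (B ` V))"
    using bezout_int by blast
  have "(\<Sum>l\<in>insert i V. (if l = i then s else t * u l) * B l) = s * B i + (\<Sum>l\<in>V. t * u l * B l)"
    using insert.hyps by (simp, intro sum.cong) auto
  also have "(\<Sum>l\<in>V. t * u l * B l) = t * Gcd (B ` V)"
    by (simp add: sum_distrib_left mult.assoc flip: u)
  finally show ?case
    using st by (auto intro!: exI[of _ "\<lambda>l. if l = i then s else t * u l"])
qed simp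

section \<open>The Evans complex as a Koszul complex\<close>

text \<open>An increasing tuple with entries in \<open>{1..k}\<close> has at most \<open>k\<close> of them, so in nonnegative degrees
  the index set is described by length and entries alone.\<close>

lemma tuples_iff:
  "a \<in> tuples k (int p) \<longleftrightarrow> length a = p \<and> set a \<subseteq> {1..k} \<and> sorted_wrt (<) a"
proof -
  have "p \<le> k" if a: "length a = p" "set a \<subseteq> {1..k}" "sorted_wrt (<) a"
  proof -
    have "p = card (set a)"
      using a by (simp add: strict_sorted_iff distinct_card)
    also have "\<dots> \<le> k"
      using card_mono[OF _ a(2)] by simp
    finally show ?thesis .
  qed
  then show ?thesis
    unfolding tuples_def by auto
qed

lemma tuple_of_set:
  assumes "S \<subseteq> {1..k}"
  shows "sorted_list_of_set S \<in> tuples k (int (card S))" "set (sorted_list_of_set S) = S"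
proof -
  have "finite S" using assms by (rule finite_subset) simp
  then show "set (sorted_list_of_set S) = S" by simp
  then show "sorted_list_of_set S \<in> tuples k (int (card S))"
    using assms by (simp add: tuples_iff)
qed

lemma set_of_tuple:
  assumes "a \<in> tuples k (int p)"
  shows "set a \<subseteq> {1..k}" "card (set a) = p" "sorted_list_of_set (set a) = a"
  using assms
  by (simp_all add: tuples_iff strict_sorted_iff distinct_card sorted_list_of_set.idem_if_sorted_distinct)

lemma finite_tuples: "finite (tuples k (int p))"
proof (rule finite_subset)
  show "tuples k (int p) \<subseteq> {a. set a \<subseteq> {1..k} \<and> length a = p}"
    by (rule subsetI) (simp only: tuples_iff mem_Collect_eq simp_thms)
  show "finite {a. set a \<subseteq> {1..k} \<and> length a = p}"
    by (rule finite_lists_length_eq) simp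
qed

text \<open>Dropping a coordinate \<open>c\<close> of an increasing tuple removes \<open>c\<close> from the underlying set, and the
  position of \<open>c\<close> is recovered by counting the smaller elements. This matches the sign
  \<open>(-1)\<^sup>i\<^sup>+\<^sup>1\<close> of the Evans differential with \<open>before_sign\<close>.\<close>

lemma remove_coord_tuple:
  assumes a: "sorted_wrt (<) a" and i: "i \<in> {1..length a}"
  shows "coord a i \<notin> set (remove_coord i a)"
    and "set a = insert (coord a i) (set (remove_coord i a))"
    and "sorted_wrt (<) (remove_coord i a)"
    and "card {x \<in> set (remove_coord i a). x < coord a i} = i - 1"
proof -
  let ?l = "take (i - 1) a" and ?c = "coord a i" and ?r = "drop i a"
  have rem: "remove_coord i a = ?l @ ?r"
    by (simp add: remove_coord_def)
  have il: "i - 1 < length a" "Suc (i - 1) = i"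
    using i by auto
  then have split: "a = ?l @ ?c # ?r"
    unfolding coord_def using id_take_nth_drop[of "i - 1" a] by simp
  have len: "length ?l = i - 1" using il(1) by simp
  have sorted: "sorted_wrt (<) (?l @ ?c # ?r)"
    using a split by simp
  have l: "\<forall>x\<in>set ?l. x < ?c" and r: "\<forall>x\<in>set ?r. ?c < x" and dl: "distinct ?l"
    using sorted by (simp_all add: sorted_wrt_append strict_sorted_iff)
  show "?c \<notin> set (remove_coord i a)"
    unfolding rem using l r by auto
  have "set a = set (?l @ ?c # ?r)" using split by simp
  then show "set a = insert ?c (set (remove_coord i a))"
    unfolding rem by simp
  show "sorted_wrt (<) (remove_coord i a)"
    unfolding rem using sorted by (simp add: sorted_wrt_append)
  have "{x \<in> set (remove_coord i a). x < ?c} = set ?l"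
    unfolding rem using l r by (auto dest: order_less_asym)
  then show "card {x \<in> set (remove_coord i a). x < ?c} = i - 1"
    using distinct_card[OF dl] len by simp
qed

lemma obtain_coord:
  assumes "c \<in> set a"
  obtains i where "i \<in> {1..length a}" "coord a i = c"
proof -
  obtain n where "n < length a" "a ! n = c"
    using assms by (auto simp: in_set_conv_nth)
  then show ?thesis
    using that[of "Suc n"] by (simp add: coord_def)
qed

text \<open>Coefficients at increasing tuples are turned into coefficients at subsets. The chains of the
  Evans complex are undefined outside their index set; extending by zero is what makes pointwise
  addition agree with addition of chains.\<close>

definition koszul_of :: "nat \<Rightarrow> nat \<Rightarrow> (nat list \<Rightarrow> int) \<Rightarrow> nat set \<Rightarrow> int" where
  "koszul_of k p m S = (if S \<subseteq> {1..k} \<and> card S = p then m (sorted_list_of_set S) else 0)"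

text \<open>The pairs \<open>(a, i)\<close> of a tuple and a position whose removal leaves \<open>b\<close> correspond to the
  elements \<open>c\<close> that can be inserted into \<open>b\<close>: \<open>c\<close> is the coordinate removed, and \<open>a\<close> lists
  \<open>b\<close> together with \<open>c\<close>.\<close>

lemma evans_diff_entry:
  assumes b: "b \<in> tuples k (int p)"
  shows "evans_diff k \<Lambda> (int (Suc p)) m b
    = contract {1..k} (coadjacency \<Lambda>) (koszul_of k (Suc p) m) (set b)"
proof -
  let ?T = "tuples k (int (Suc p))" and ?I = "{1..Suc p}"
  let ?P = "{(a, i). a \<in> ?T \<and> i \<in> ?I \<and> remove_coord i a = b}"
  let ?g = "\<lambda>(a, i). (-1) ^ (i + 1) * (if b = remove_coord i a then 1 else 0)
      * coadjacency \<Lambda> (coord a i) * m a"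
  let ?ins = "\<lambda>c. sorted_list_of_set (insert c (set b))"
  let ?pos = "\<lambda>c. Suc (card {x \<in> set b. x < c})"
  note bs = set_of_tuple[OF b]
  have b_sorted: "sorted_wrt (<) b" using b by (simp add: tuples_iff)
  have ins: "?ins c \<in> ?T" "set (?ins c) = insert c (set b)" "card (insert c (set b)) = Suc p"
    if c: "c \<in> {1..k} - set b" for c
  proof -
    have sub: "insert c (set b) \<subseteq> {1..k}" using c bs(1) by simp
    show card: "card (insert c (set b)) = Suc p" using c bs(2) by simp
    show "?ins c \<in> ?T" "set (?ins c) = insert c (set b)"
      using tuple_of_set[OF sub] unfolding card by simp_all
  qed
  have T: "sorted_wrt (<) a" "length a = Suc p" "set a \<subseteq> {1..k}" "sorted_list_of_set (set a) = a"
    if "a \<in> ?T" for a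
    using that set_of_tuple(3)[OF that] by (simp_all only: tuples_iff)
  have P1: "coord a i \<in> {1..k} - set b" "?ins (coord a i) = a" "?pos (coord a i) = i"
    if ai: "a \<in> ?T" "i \<in> ?I" "remove_coord i a = b" for a i
  proof -
    have i: "i \<in> {1..length a}" using T(2)[OF ai(1)] ai(2) by simp
    note R = remove_coord_tuple[OF T(1)[OF ai(1)] i, unfolded ai(3)]
    show "coord a i \<in> {1..k} - set b" using R(1,2) T(3)[OF ai(1)] by simp
    show "?ins (coord a i) = a" using R(2) T(4)[OF ai(1)] by simp
    show "?pos (coord a i) = i" using R(4) ai(2) by simp
  qed
  have P2: "remove_coord (?pos c) (?ins c) = b" "?pos c \<in> ?I" "coord (?ins c) (?pos c) = c"
    if c: "c \<in> {1..k} - set b" for c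
  proof -
    note aT = ins(1)[OF c]
    have "c \<in> set (?ins c)" using ins(2)[OF c] by simp
    then obtain i where i: "i \<in> {1..length (?ins c)}" "coord (?ins c) i = c"
      by (rule obtain_coord)
    note R = remove_coord_tuple[OF T(1)[OF aT] i(1), unfolded i(2)]
    have "insert c (set b) = insert c (set (remove_coord i (?ins c)))"
      using R(2) ins(2)[OF c] by simp
    then have "set (remove_coord i (?ins c)) = set b"
      using R(1) c by (metis DiffD2 insert_ident)
    then have rb: "remove_coord i (?ins c) = b"
      using R(3) b_sorted by (metis strict_sorted_equal)
    have "?pos c = i" using R(4) i(1) unfolding rb by simp
    then show "remove_coord (?pos c) (?ins c) = b" "?pos c \<in> ?I" "coord (?ins c) (?pos c) = c"
      using rb i T(2)[OF aT] by simp_all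
  qed
  have "int (Suc p) - 1 = int p" by simp
  then have "evans_diff k \<Lambda> (int (Suc p)) m b = (\<Sum>a\<in>?T. \<Sum>i\<in>?I. ?g (a, i))"
    by (simp only: evans_diff_def nat_int restrict_apply'[OF b] prod.case)
  also have "\<dots> = (\<Sum>q\<in>?T \<times> ?I. ?g q)"
    by (simp only: sum.cartesian_product case_prod_eta)
  also have "\<dots> = (\<Sum>q\<in>?P. ?g q)"
  proof (rule sum.mono_neutral_right)
    show "finite (?T \<times> ?I)" by (intro finite_cartesian_product finite_tuples) simp
    show "?P \<subseteq> ?T \<times> ?I" by blast
    show "\<forall>q\<in>?T \<times> ?I - ?P. ?g q = 0" by auto
  qed
  also have "\<dots> = (\<Sum>c\<in>{1..k} - set b. before_sign c (set b) * coadjacency \<Lambda> c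
      * koszul_of k (Suc p) m (insert c (set b)))"
  proof (rule sum.reindex_bij_witness[where j = "\<lambda>(a, i). coord a i" and i = "\<lambda>c. (?ins c, ?pos c)"])
    fix q assume "q \<in> ?P"
    then obtain a i where q: "q = (a, i)" and ai: "a \<in> ?T" "i \<in> ?I" "remove_coord i a = b"
      by blast
    note C = P1[OF ai]
    show "(case q of (a, i) \<Rightarrow> coord a i) \<in> {1..k} - set b" using C(1) q by simp
    show "(?ins (case q of (a, i) \<Rightarrow> coord a i), ?pos (case q of (a, i) \<Rightarrow> coord a i)) = q"
      using C(2,3) q by simp
    have "koszul_of k (Suc p) m (insert (coord a i) (set b)) = m a"
      using C(1,2) bs(1) ins(3)[OF C(1)] by (simp add: koszul_of_def)
    moreover have "before_sign (coord a i) (set b) = (-1) ^ (i + 1)"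
    proof -
      \<comment> \<open>The position \<open>i\<close> is one more than the number of smaller elements, whence the two extra
            sign factors.\<close>
      have "(-1 :: int) ^ (i + 1) = (-1) ^ (card {x \<in> set b. x < coord a i} + 2)"
        using C(3) by simp
      then show ?thesis by (simp add: before_sign_def)
    qed
    ultimately show "before_sign (case q of (a, i) \<Rightarrow> coord a i) (set b)
        * coadjacency \<Lambda> (case q of (a, i) \<Rightarrow> coord a i)
        * koszul_of k (Suc p) m (insert (case q of (a, i) \<Rightarrow> coord a i) (set b)) = ?g q"
      using q ai(3) by simp
  next
    fix c assume c: "c \<in> {1..k} - set b"
    show "(case (?ins c, ?pos c) of (a, i) \<Rightarrow> coord a i) = c" using P2(3)[OF c] by simp
    show "(?ins c, ?pos c) \<in> ?P" using P2(1,2)[OF c] ins(1)[OF c] by simp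
  qed
  finally show ?thesis
    unfolding contract_def .
qed

lemma carrier_evans_chain: "carrier (evans_chain k (int p)) = (\<Pi>\<^sub>E a\<in>tuples k (int p). UNIV)"
  unfolding evans_chain_def using finite_tuples[of k p]
  by (subst carrier_sum_group) simp_all

lemma group_evans_chain: "group (evans_chain k p)"
  by (simp add: evans_chain_def)

lemma mult_evans_chain:
  "x \<otimes>\<^bsub>evans_chain k p\<^esub> y = (\<lambda>a\<in>tuples k p. x a + y a)"
  by (simp add: evans_chain_def)

lemma one_evans_chain: "\<one>\<^bsub>evans_chain k p\<^esub> = (\<lambda>a\<in>tuples k p. 0)"
  by (simp add: evans_chain_def)

lemma koszul_of_in_chains: "koszul_of k p m \<in> koszul_chains {1..k} p"
proof (rule koszul_chainsI)
  fix S assume "koszul_of k p m S \<noteq> 0"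
  then show "S \<subseteq> {1..k} \<and> card S = p"
    unfolding koszul_of_def by presburger
qed

lemma koszul_of_set:
  assumes "S \<subseteq> {1..k} \<and> card S = p"
  shows "koszul_of k p m S = m (sorted_list_of_set S)" "sorted_list_of_set S \<in> tuples k (int p)"
    and "set (sorted_list_of_set S) = S"
proof -
  show "koszul_of k p m S = m (sorted_list_of_set S)"
    by (simp only: koszul_of_def assms if_True simp_thms)
  show "sorted_list_of_set S \<in> tuples k (int p)" "set (sorted_list_of_set S) = S"
    using tuple_of_set[OF conjunct1[OF assms]] unfolding conjunct2[OF assms] .
qed

lemma koszul_of_not_set: "\<not> (S \<subseteq> {1..k} \<and> card S = p) \<Longrightarrow> koszul_of k p m S = 0"
  by (simp only: koszul_of_def if_False)

lemma koszul_of_tuple: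
  "a \<in> tuples k (int p) \<Longrightarrow> koszul_of k p m (set a) = m a"
  using koszul_of_set(1)[of "set a" k p m] set_of_tuple[of a k p] by (simp only: simp_thms)

lemma koszul_of_inj:
  assumes "m \<in> carrier (evans_chain k (int p))" "m' \<in> carrier (evans_chain k (int p))"
    and "koszul_of k p m = koszul_of k p m'"
  shows "m = m'"
proof (rule PiE_ext)
  show "m \<in> (\<Pi>\<^sub>E a\<in>tuples k (int p). UNIV)" "m' \<in> (\<Pi>\<^sub>E a\<in>tuples k (int p). UNIV)"
    using assms(1,2) by (simp_all only: carrier_evans_chain)
  show "m a = m' a" if "a \<in> tuples k (int p)" for a
    using koszul_of_tuple[OF that, of m] koszul_of_tuple[OF that, of m'] assms(3) by simp
qed

lemma koszul_of_surj:
  assumes x: "x \<in> koszul_chains {1..k} p"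
  obtains m where "m \<in> carrier (evans_chain k (int p))" "koszul_of k p m = x"
proof
  let ?m = "\<lambda>a\<in>tuples k (int p). x (set a)"
  show "?m \<in> carrier (evans_chain k (int p))"
    by (simp add: carrier_evans_chain)
  show "koszul_of k p ?m = x"
  proof
    fix S
    show "koszul_of k p ?m S = x S"
    proof (cases "S \<subseteq> {1..k} \<and> card S = p")
      case True
      note t = koszul_of_set[OF True]
      show ?thesis
        unfolding t(1) restrict_apply'[OF t(2)] t(3) by (rule refl)
    next
      case False
      show ?thesis
        unfolding koszul_of_not_set[OF False] koszul_chains_zero[OF x False] by (rule refl)
    qed
  qed
qed

lemma koszul_of_mult:
  "koszul_of k p (m \<otimes>\<^bsub>evans_chain k (int p)\<^esub> m')
     = (\<lambda>S. 1 * koszul_of k p m S + 1 * koszul_of k p m' S)"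
proof
  fix S
  show "koszul_of k p (m \<otimes>\<^bsub>evans_chain k (int p)\<^esub> m') S
     = 1 * koszul_of k p m S + 1 * koszul_of k p m' S"
  proof (cases "S \<subseteq> {1..k} \<and> card S = p")
    case True
    note t = koszul_of_set[OF True]
    show ?thesis
      unfolding t(1) mult_evans_chain restrict_apply'[OF t(2)] by simp
  next
    case False
    show ?thesis
      unfolding koszul_of_not_set[OF False] by simp
  qed
qed

lemma koszul_of_one: "koszul_of k p \<one>\<^bsub>evans_chain k (int p)\<^esub> = (\<lambda>_. 0)"
proof
  fix S
  show "koszul_of k p \<one>\<^bsub>evans_chain k (int p)\<^esub> S = 0"
  proof (cases "S \<subseteq> {1..k} \<and> card S = p")
    case True
    note t = koszul_of_set[OF True]
    show ?thesis
      unfolding t(1) one_evans_chain restrict_apply'[OF t(2)] by (rule refl)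
  next
    case False
    show ?thesis by (rule koszul_of_not_set[OF False])
  qed
qed

lemma evans_diff_in_chain: "evans_diff k \<Lambda> (int (Suc p)) m \<in> carrier (evans_chain k (int p))"
  by (simp add: evans_diff_def carrier_evans_chain)

lemma koszul_of_evans_diff:
  "koszul_of k p (evans_diff k \<Lambda> (int (Suc p)) m)
     = contract {1..k} (coadjacency \<Lambda>) (koszul_of k (Suc p) m)"
proof
  fix S
  let ?B = "coadjacency \<Lambda>"
  show "koszul_of k p (evans_diff k \<Lambda> (int (Suc p)) m) S = contract {1..k} ?B (koszul_of k (Suc p) m) S"
  proof (cases "S \<subseteq> {1..k} \<and> card S = p")
    case True
    note t = koszul_of_set[OF True]
    show ?thesis
      unfolding t(1) using evans_diff_entry[OF t(2)] unfolding t(3) .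
  next
    case False
    have "contract {1..k} ?B (koszul_of k (Suc p) m) \<in> koszul_chains {1..k} p"
      by (intro contract_in_koszul_chains koszul_of_in_chains) simp
    then have "contract {1..k} ?B (koszul_of k (Suc p) m) S = 0"
      by (rule koszul_chains_zero) (rule False)
    then show ?thesis
      unfolding koszul_of_not_set[OF False] by (rule sym)
  qed
qed

section \<open>The homology of the Evans complex\<close>

text \<open>In degree \<open>0\<close> both conditions hold for every chain: the Evans differential has the trivial
  group as its target, and contraction vanishes.\<close>

lemma evans_kernel_iff:
  "m \<in> kernel (evans_chain k (int p)) (evans_chain k (int p - 1)) (evans_diff k \<Lambda> (int p))
     \<longleftrightarrow> m \<in> carrier (evans_chain k (int p)) \<and> koszul_of k p m \<in> koszul_cycles {1..k} (coadjacency \<Lambda>) p"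
proof (cases p)
  case 0
  have "evans_diff k \<Lambda> (int 0) m = \<one>\<^bsub>evans_chain k (int 0 - 1)\<^esub>"
    by (simp add: evans_diff_def one_evans_chain tuples_def)
  moreover have "koszul_of k 0 m \<in> koszul_cycles {1..k} (coadjacency \<Lambda>) 0"
    using contract_degree_0[OF _ koszul_of_in_chains, of k] koszul_of_in_chains[of k 0 m]
    by (simp add: koszul_cycles_def)
  ultimately show ?thesis
    unfolding 0 kernel_def by simp
next
  case (Suc p')
  have "evans_diff k \<Lambda> (int (Suc p')) m = \<one>\<^bsub>evans_chain k (int p')\<^esub>
    \<longleftrightarrow> koszul_of k p' (evans_diff k \<Lambda> (int (Suc p')) m) = (\<lambda>_. 0)"
    using koszul_of_inj[OF evans_diff_in_chain monoid.one_closed[OF group.is_monoid[OF group_evans_chain]]]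
      koszul_of_one by metis
  then show ?thesis
    unfolding Suc kernel_def koszul_of_evans_diff
    using koszul_of_in_chains[of k "Suc p'" m] by (simp add: koszul_cycles_def)
qed

lemma subgroup_evans_kernel:
  "subgroup (kernel (evans_chain k (int p)) (evans_chain k (int p - 1)) (evans_diff k \<Lambda> (int p)))
     (evans_chain k (int p))"
proof -
  have "group_hom (evans_chain k (int p)) (evans_chain k (int p - 1)) (evans_diff k \<Lambda> (int p))"
  proof (intro group_hom.intro group_evans_chain group_hom_axioms.intro homI)
    fix x y
    show "evans_diff k \<Lambda> (int p) x \<in> carrier (evans_chain k (int p - 1))"
    proof (cases p)
      case 0
      then show ?thesis
        by (simp add: evans_diff_def evans_chain_def tuples_def carrier_sum_group restrict_def)
    next
      case (Suc p')
      then show ?thesis using evans_diff_in_chain[of k \<Lambda> p' x] by simp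
    qed
    show "evans_diff k \<Lambda> (int p) (x \<otimes>\<^bsub>evans_chain k (int p)\<^esub> y)
        = evans_diff k \<Lambda> (int p) x \<otimes>\<^bsub>evans_chain k (int p - 1)\<^esub> evans_diff k \<Lambda> (int p) y"
      unfolding mult_evans_chain evans_diff_def
    proof (rule restrict_ext)
      fix b assume b: "b \<in> tuples k (int p - 1)"
      show "(\<Sum>a\<in>tuples k (int p). \<Sum>i=1..nat (int p). (-1) ^ (i + 1)
            * (if b = remove_coord i a then 1 else 0) * coadjacency \<Lambda> (coord a i)
            * (\<lambda>a\<in>tuples k (int p). x a + y a) a)
        = (\<lambda>b\<in>tuples k (int p - 1). \<Sum>a\<in>tuples k (int p). \<Sum>i=1..nat (int p). (-1) ^ (i + 1)
            * (if b = remove_coord i a then 1 else 0) * coadjacency \<Lambda> (coord a i) * x a) b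
        + (\<lambda>b\<in>tuples k (int p - 1). \<Sum>a\<in>tuples k (int p). \<Sum>i=1..nat (int p). (-1) ^ (i + 1)
            * (if b = remove_coord i a then 1 else 0) * coadjacency \<Lambda> (coord a i) * y a) b"
        unfolding restrict_apply'[OF b] sum.distrib[symmetric] distrib_left[symmetric]
        by (intro sum.cong refl) simp
    qed
  qed
  then show ?thesis by (rule group_hom.subgroup_kernel)
qed

text \<open>Take coordinates of a cycle with respect to a basis of \<open>Z\<^sub>p\<close> and reduce them modulo \<open>g\<close>.
  A cycle is sent to zero exactly if all its coordinates, hence the cycle itself, are divisible by
  \<open>g\<close> within \<open>Z\<^sub>p\<close>, that is, exactly if it is a boundary.\<close>

lemma evans_homology_iso:
  assumes k: "k \<ge> 1" and nz: "\<exists>i\<in>{1..k}. coadjacency \<Lambda> i \<noteq> 0"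
    and g: "int g = Gcd (coadjacency \<Lambda> ` {1..k})"
  shows "evans_homology k \<Lambda> (int p)
    \<cong> product_group {..<(k - 1) choose p} (\<lambda>_. integer_mod_group g)"
proof -
  let ?V = "{1..k}" and ?B = "coadjacency \<Lambda>" and ?r = "(k - 1) choose p"
  let ?C = "evans_chain k (int p)" and ?d = "evans_diff k \<Lambda>"
  let ?Z = "kernel ?C (evans_chain k (int p - 1)) (?d (int p))"
  let ?K = "subgroup_generated ?C ?Z"
  let ?H = "product_group {..<?r} (\<lambda>_. integer_mod_group g)"
  have g0: "int g > 0"
    using nz g by (metis Gcd_0_iff image_subset_iff of_nat_0_less_iff of_nat_eq_0_iff gr0I singletonD)
  define B' where "B' = (\<lambda>i. ?B i div int g)"
  have B: "\<forall>i\<in>?V. ?B i = int g * B' i"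
    unfolding B'_def g by (auto intro!: dvd_mult_div_cancel[symmetric] Gcd_dvd)
  obtain u where "(\<Sum>i\<in>?V. u i * ?B i) = int g"
    using Gcd_int_linear_combination[of ?V ?B] g by auto
  moreover have "(\<Sum>i\<in>?V. u i * ?B i) = int g * (\<Sum>i\<in>?V. u i * B' i)"
    unfolding sum_distrib_left using B by (intro sum.cong refl) simp
  ultimately have uB: "(\<Sum>i\<in>?V. u i * B' i) = 1"
    using g0 by simp
  let ?Z' = "koszul_cycles ?V B' p"
  have Z_iff: "m \<in> ?Z \<longleftrightarrow> m \<in> carrier ?C \<and> koszul_of k p m \<in> ?Z'" for m
    unfolding evans_kernel_iff using koszul_cycles_scale[OF B, of p] g0 by simp
  have bd: "contract ?V ?B ` koszul_chains ?V (Suc p) = (\<lambda>z S. int g * z S) ` ?Z'"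
    by (rule koszul_boundaries_scale[OF _ uB B]) simp
  have "free_of_rank ?Z' ?r"
    using koszul_cycles_free[OF _ _ uB, of p] k by simp
  then obtain c where c: "int_linear_on ?Z' c" and bij: "bij_betw c ?Z' (int_functions {..<?r})"
    unfolding free_of_rank_def by blast
  define \<phi> where "\<phi> = (\<lambda>m. \<lambda>n\<in>{..<?r}. c (koszul_of k p m) n mod int g)"
  have carrier_K: "carrier ?K = ?Z"
    by (rule subgroup.carrier_subgroup_generated_subgroup[OF subgroup_evans_kernel])
  have carrier_H: "carrier ?H = (\<Pi>\<^sub>E n\<in>{..<?r}. {0..<int g})"
    using g0 by (simp add: carrier_integer_mod_group)
  have hom: "group_hom ?K ?H \<phi>"
  proof (intro group_hom.intro group_hom_axioms.intro homI)
    show "group ?K" by (rule group.group_subgroup_generated[OF group_evans_chain])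
    show "group ?H" by simp
    show "\<phi> m \<in> carrier ?H" for m
      unfolding carrier_H \<phi>_def using g0 by (intro restrict_PiE_iff[THEN iffD2] ballI) simp
    fix x y assume xy: "x \<in> carrier ?K" "y \<in> carrier ?K"
    have "c (koszul_of k p (x \<otimes>\<^bsub>?C\<^esub> y))
      = (\<lambda>n. 1 * c (koszul_of k p x) n + 1 * c (koszul_of k p y) n)"
      unfolding koszul_of_mult using xy unfolding carrier_K Z_iff by (intro int_linear_onD[OF c]) simp_all
    then show "\<phi> (x \<otimes>\<^bsub>?K\<^esub> y) = \<phi> x \<otimes>\<^bsub>?H\<^esub> \<phi> y"
      unfolding \<phi>_def by (simp add: mod_add_eq restrict_def fun_eq_iff)
  qed
  have surj: "\<phi> ` carrier ?K = carrier ?H"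
  proof (intro equalityI subsetI)
    show "w \<in> carrier ?H" if "w \<in> \<phi> ` carrier ?K" for w
      using that group_hom.hom_closed[OF hom] by blast
    fix w assume w: "w \<in> carrier ?H"
    have "(\<lambda>n. if n < ?r then w n else 0) \<in> int_functions {..<?r}"
      by (rule int_functionsI) (simp split: if_splits)
    then obtain z where z: "z \<in> ?Z'" "c z = (\<lambda>n. if n < ?r then w n else 0)"
      using bij_betw_imp_surj_on[OF bij] by (metis (no_types, lifting) imageE)
    obtain m where m: "m \<in> carrier ?C" "koszul_of k p m = z"
      using koszul_of_surj[of z k p] z(1) unfolding koszul_cycles_def by blast
    have "w = \<phi> m"
    proof (rule PiE_ext)
      show "w \<in> (\<Pi>\<^sub>E n\<in>{..<?r}. {0..<int g})" using w unfolding carrier_H .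
      have "m \<in> carrier ?K"
        unfolding carrier_K Z_iff using m z(1) by simp
      then have "\<phi> m \<in> carrier ?H" by (rule group_hom.hom_closed[OF hom])
      then show "\<phi> m \<in> (\<Pi>\<^sub>E n\<in>{..<?r}. {0..<int g})" unfolding carrier_H .
      fix n assume n: "n \<in> {..<?r}"
      then have "w n \<in> {0..<int g}" using w unfolding carrier_H by (rule PiE_mem[rotated])
      then show "w n = \<phi> m n" using n by (simp add: \<phi>_def m(2) z(2))
    qed
    then show "w \<in> \<phi> ` carrier ?K"
      unfolding carrier_K using m z(1) by (intro image_eqI[of _ _ m]) (simp_all add: Z_iff)
  qed
  have ker: "kernel ?K ?H \<phi> = ?d (int p + 1) ` carrier (evans_chain k (int p + 1))"
  proof (intro equalityI subsetI)
    fix m assume "m \<in> kernel ?K ?H \<phi>"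
    then have "m \<in> ?Z" and \<phi>m: "\<phi> m = \<one>\<^bsub>?H\<^esub>"
      unfolding kernel_def[of ?K] carrier_K by blast+
    then have m: "m \<in> carrier ?C" "koszul_of k p m \<in> ?Z'"
      unfolding Z_iff by blast+
    have dvd: "c (koszul_of k p m) n mod int g = 0" if "n < ?r" for n
      using fun_cong[OF \<phi>m, of n] that by (simp add: \<phi>_def)
    define v where "v = (\<lambda>n. c (koszul_of k p m) n div int g)"
    have cm: "c (koszul_of k p m) \<in> int_functions {..<?r}"
      using bij m(2) by (rule bij_betw_apply)
    have v: "v \<in> int_functions {..<?r}"
    proof (rule int_functionsI)
      fix n assume "v n \<noteq> 0"
      then have "c (koszul_of k p m) n \<noteq> 0" unfolding v_def by (metis div_0)
      then show "n \<in> {..<?r}" using int_functions_zero[OF cm] by blast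
    qed
    have gv: "c (koszul_of k p m) n = int g * v n" for n
    proof (cases "n < ?r")
      case True
      then show ?thesis using dvd[OF True] unfolding v_def by (simp add: mod_eq_0_iff_dvd)
    next
      case False
      then show ?thesis using int_functions_zero[OF cm, of n] unfolding v_def by simp
    qed
    obtain z where z: "z \<in> ?Z'" "c z = v"
      using v bij_betw_imp_surj_on[OF bij] by (metis imageE)
    have "koszul_of k p m = (\<lambda>S. int g * z S)"
    proof (rule inj_onD[OF bij_betw_imp_inj_on[OF bij]])
      show "c (koszul_of k p m) = c (\<lambda>S. int g * z S)"
        unfolding int_linear_on_scale[OF c z(1)] z(2) by (rule ext) (rule gv)
      show "(\<lambda>S. int g * z S) \<in> ?Z'"
        by (rule int_closed_scale[OF int_closed_koszul_cycles z(1)])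
    qed (rule m(2))
    then have "koszul_of k p m \<in> contract ?V ?B ` koszul_chains ?V (Suc p)"
      unfolding bd using z(1) by (intro image_eqI)
    then obtain y where y: "koszul_of k p m = contract ?V ?B y" "y \<in> koszul_chains ?V (Suc p)"
      by (rule imageE)
    obtain m' where m': "m' \<in> carrier (evans_chain k (int (Suc p)))" "koszul_of k (Suc p) m' = y"
      using koszul_of_surj[OF y(2)] .
    have "m = ?d (int (Suc p)) m'"
      using m(1) evans_diff_in_chain
      by (rule koszul_of_inj) (simp only: koszul_of_evans_diff m'(2) y(1))
    then show "m \<in> ?d (int p + 1) ` carrier (evans_chain k (int p + 1))"
      using m'(1) by (simp add: add.commute)
  next
    fix m assume "m \<in> ?d (int p + 1) ` carrier (evans_chain k (int p + 1))"
    then have "m \<in> ?d (int (Suc p)) ` carrier (evans_chain k (int (Suc p)))"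
      by (simp add: add.commute)
    then obtain m' where m': "m = ?d (int (Suc p)) m'" by (rule imageE)
    have mC: "m \<in> carrier ?C" unfolding m' by (rule evans_diff_in_chain)
    have "koszul_of k p m \<in> contract ?V ?B ` koszul_chains ?V (Suc p)"
      unfolding m' koszul_of_evans_diff by (intro imageI koszul_of_in_chains)
    then obtain z where z: "koszul_of k p m = (\<lambda>S. int g * z S)" "z \<in> ?Z'"
      unfolding bd by (rule imageE)
    have "m \<in> ?Z"
      unfolding Z_iff z(1) using mC int_closed_scale[OF int_closed_koszul_cycles z(2)] by simp
    moreover have "\<phi> m = (\<lambda>n\<in>{..<?r}. 0)"
      unfolding \<phi>_def z(1) int_linear_on_scale[OF c z(2)] by simp
    ultimately show "m \<in> kernel ?K ?H \<phi>"
      unfolding kernel_def[of ?K] carrier_K by simp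
  qed
  show ?thesis
    unfolding evans_homology_def using group_hom.FactGroup_iso[OF hom surj] unfolding ker .
qed

section \<open>The second page\<close>

lemma isomorphic_trivial_groups:
  assumes "trivial_group G" "trivial_group H"
  shows "G \<cong> H"
proof (rule is_isoI)
  interpret H: group H using assms(2) by (simp add: trivial_group_def)
  show "(\<lambda>_. \<one>\<^bsub>H\<^esub>) \<in> iso G H"
    using assms by (auto simp: iso_def hom_def bij_betw_def trivial_group_def)
qed

theorem theorem3p9:
  fixes k :: nat and \<Lambda> :: "('o, 'm) kgraph"
    and E2 :: "int \<Rightarrow> int \<Rightarrow> 'e monoid" and g :: nat
  assumes "k \<ge> 1"
    and "monoid_k_graph k \<Lambda>"
    and "source_free k \<Lambda>"
    and "row_finite k \<Lambda>"
    and "\<exists>i\<in>{1..k}. coadjacency \<Lambda> i \<noteq> 0"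
    and "int g = Gcd (coadjacency \<Lambda> ` {1..k})"
    and "kasparov_schochet_E2 k \<Lambda> E2"
  shows "\<forall>p q. if even q
    then E2 p q \<cong> product_group {..<(if 0 \<le> p then (k - 1) choose nat p else 0)} (\<lambda>_. integer_mod_group g)
    else trivial_group (E2 p q)"
proof (intro allI)
  fix p q :: int
  let ?r = "if 0 \<le> p then (k - 1) choose nat p else 0"
  let ?H = "product_group {..<?r} (\<lambda>_. integer_mod_group g)"
  have E: "if 0 \<le> p \<and> p \<le> int k \<and> even q then E2 p q \<cong> evans_homology k \<Lambda> p
      else trivial_group (E2 p q)"
    using assms(7) unfolding kasparov_schochet_E2_def by blast
  show "if even q then E2 p q \<cong> ?H else trivial_group (E2 p q)"
  proof (cases "even q")
    case q: True
    have "E2 p q \<cong> ?H"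
    proof (cases "0 \<le> p \<and> p \<le> int k")
      case True
      then have "E2 p q \<cong> evans_homology k \<Lambda> (int (nat p))"
        using E q by simp
      then have "E2 p q \<cong> product_group {..<(k - 1) choose nat p} (\<lambda>_. integer_mod_group g)"
        using evans_homology_iso[OF assms(1,5,6)] by (rule iso_trans)
      then show ?thesis using True by simp
    next
      case False
      have "?r = 0"
        using False assms(1) by (auto simp: binomial_eq_0)
      then have "trivial_group ?H"
        by (simp only: trivial_product_group) simp
      moreover have "trivial_group (E2 p q)"
        using E False by (simp only: if_False simp_thms conj_assoc[symmetric])
      ultimately show ?thesis
        by (simp add: isomorphic_trivial_groups)
    qed
    then show ?thesis using q by simp
  next
    case False
    then show ?thesis using E by simp
  qed
qed

end
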